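(* Fix $0<\beta<\alpha<1$. Then for every regular $((1-\alpha)d/2,(1-\beta)d/2,p_1,p_2,p_q,p_u)$-sensitive filter family in $d$-dimensional Hamming space with $|Q|/2^d=(|U|/2^d)^{\alpha^{2\lambda}}$, where $\lambda$ satisfies $$\alpha+2\sqrt{\ln(d)/d}\ \le\ \alpha^{\lambda}\ \le\ \frac{1}{\alpha-2\sqrt{\ln(d)/d}},$$ it must hold that $$\rho_q=\frac{\log(p_q/p_1)}{\log(p_q/p_2)}\ \ge\ \frac{(1-\alpha^{1+\lambda})^2}{1-\alpha^2}-o_d(1),\qquad \rho_u=\frac{\log(p_u/p_1)}{\log(p_q/p_2)}\ \ge\ \frac{(\alpha^{\lambda}-\alpha)^2}{1-\alpha^2}-o_d(1),$$ when $p_q$ is set to minimize $\rho_q$ and we assume that $|U|/2^d\ge 2^{-o(d)}$.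
   Context: $d$-dimensional Hamming space is $X=\{0,1\}^d$ with $D(\mathbf{x},\mathbf{y})=\|\mathbf{x}-\mathbf{y}\|_1$. A filter family is a probability distribution $\mathcal{F}$ over pairs $(Q,U)$ with $Q,U\subseteq X$. It is $(r_1,r_2,p_1,p_2,p_q,p_u)$-sensitive if for all $\mathbf{x},\mathbf{y}\in X$ and $(Q,U)\sim\mathcal{F}$: (i) if $D(\mathbf{x},\mathbf{y})\le r_1$ then $\Pr[\mathbf{x}\in Q,\mathbf{y}\in U]\ge p_1$; (ii) if $D(\mathbf{x},\mathbf{y})>r_2$ then $\Pr[\mathbf{x}\in Q,\mathbf{y}\in U]\le p_2$; (iii) $\Pr[\mathbf{x}\in Q]\le p_q$ and $\Pr[\mathbf{x}\in U]\le p_u$. It is implicit that $p_q,p_u>p_1>p_2>0$. The family is regular if all query filters $Q$ have the same size $|Q|$ and all update filters $U$ have the same size $|U|$. "$p_q$ is set to minimize $\rho_q$" means that, for the given $p_1,p_2$, the parameter $p_q$ is chosen as small as possible subject to the family being sensitive. The notation $o_d(1)$ and $o(d)$ refers to $d\to\infty$. *)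

theory Defs
  imports "HOL-Probability.Probability" "HOL-Library.Landau_Symbols"
begin

text \<open>
  The dimension is an explicit natural number because the statement is asymptotic in it.
  Points are extensional functions, so that the cube has exactly \<open>2 ^ d\<close> elements.
\<close>

definition cube :: "nat \<Rightarrow> (nat \<Rightarrow> real) set" where
  "cube d = {..<d} \<rightarrow>\<^sub>E {0, 1}"

definition hamming_dist :: "nat \<Rightarrow> (nat \<Rightarrow> real) \<Rightarrow> (nat \<Rightarrow> real) \<Rightarrow> real" where
  "hamming_dist d x y = (\<Sum>i<d. \<bar>x i - y i\<bar>)"

text \<open>
  A filter is a subset of the cube. There are only finitely many of them, so every probability
  distribution over pairs (query filter, update filter) is a probability mass function.
\<close>

type_synonym point_filter = "(nat \<Rightarrow> real) set"

definition filter_family :: "nat \<Rightarrow> (point_filter \<times> point_filter) pmf \<Rightarrow> bool" where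
  "filter_family d F \<longleftrightarrow> set_pmf F \<subseteq> Pow (cube d) \<times> Pow (cube d)"

text \<open>
  The usually implicit side condition \<open>p\<^sub>q, p\<^sub>u > p\<^sub>1 > p\<^sub>2 > 0\<close> is part of sensitivity.
\<close>

definition sensitive ::
    "nat \<Rightarrow> (point_filter \<times> point_filter) pmf \<Rightarrow>
      real \<Rightarrow> real \<Rightarrow> real \<Rightarrow> real \<Rightarrow> real \<Rightarrow> real \<Rightarrow> bool" where
  "sensitive d F r1 r2 p1 p2 pq pu \<longleftrightarrow>
     0 < p2 \<and> p2 < p1 \<and> p1 < pq \<and> p1 < pu \<and>
     (\<forall>x\<in>cube d. \<forall>y\<in>cube d.
        (hamming_dist d x y \<le> r1 \<longrightarrow>
           measure_pmf.prob F {(Q, U). x \<in> Q \<and> y \<in> U} \<ge> p1) \<and>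
        (hamming_dist d x y > r2 \<longrightarrow>
           measure_pmf.prob F {(Q, U). x \<in> Q \<and> y \<in> U} \<le> p2)) \<and>
     (\<forall>x\<in>cube d.
        measure_pmf.prob F {(Q, U). x \<in> Q} \<le> pq \<and>
        measure_pmf.prob F {(Q, U). x \<in> U} \<le> pu)"

definition regular_family :: "(point_filter \<times> point_filter) pmf \<Rightarrow> bool" where
  "regular_family F \<longleftrightarrow>
     (\<exists>a b. \<forall>(Q, U)\<in>set_pmf F. card Q = a \<and> card U = b)"

definition rho_q :: "real \<Rightarrow> real \<Rightarrow> real \<Rightarrow> real" where
  "rho_q p1 p2 pq = ln (pq / p1) / ln (pq / p2)"

definition rho_u :: "real \<Rightarrow> real \<Rightarrow> real \<Rightarrow> real \<Rightarrow> real" where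
  "rho_u p1 p2 pq pu = ln (pu / p1) / ln (pq / p2)"

text \<open>
  Given the remaining parameters, \<open>p\<^sub>q\<close> is the least value for which the family is sensitive.
  Since \<open>p\<^sub>2 < p\<^sub>1\<close>, \<open>rho_q\<close> is increasing in \<open>p\<^sub>q\<close>, so this is
  the choice that minimizes \<open>rho_q\<close>.
\<close>

definition minimal_pq ::
    "nat \<Rightarrow> (point_filter \<times> point_filter) pmf \<Rightarrow>
      real \<Rightarrow> real \<Rightarrow> real \<Rightarrow> real \<Rightarrow> real \<Rightarrow> real \<Rightarrow> bool" where
  "minimal_pq d F r1 r2 p1 p2 pq pu \<longleftrightarrow>
     sensitive d F r1 r2 p1 p2 pq pu \<and>
     (\<forall>pq'. sensitive d F r1 r2 p1 p2 pq' pu \<longrightarrow> pq \<le> pq')"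

end

theory Submission
  imports Defs "HOL-Real_Asymp.Real_Asymp"
begin

text \<open>
  Let \<open>u\<close> be the density of the update filters and \<open>t = \<alpha> powr l\<close>, so that the query
  filters have density \<open>u powr t\<^sup>2\<close>. Averaging the collision probability over pairs of
  points whose correlation \<open>\<sigma>\<close> is slightly larger than \<open>\<alpha>\<close>, so that they are close
  with high probability, the generalized small-set expansion theorem bounds \<open>p1\<close> from above.
  Averaging over the points far from one that attains \<open>pq\<close> gives, up to an exponentially
  small error, \<open>p2 \<ge> pq u\<close>. Both exponents follow from
  \<open>- ln p1 \<ge> ((1 - \<alpha> t)\<^sup>2 / (1 - \<alpha>\<^sup>2) + t\<^sup>2 - o(1)) ln (1 / u)\<close>. Since \<open>u\<close> may be
  arbitrarily close to \<open>1\<close>, all errors have to be kept relative to \<open>ln (1 / u)\<close>; when that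
  quantity is small, expansion is applied to the complements of the filters instead.
\<close>

section \<open>Two-point hypercontractivity\<close>

text \<open>The correlation is \<open>\<sigma> = \<alpha> + \<eta>\<close> with
  \<open>\<eta> = sqrt (ln d / d)\<close>: a noisy pair exceeds distance \<open>r1\<close> with
  probability at most \<open>exp (- d \<eta>\<^sup>2 / 8)\<close>, a negative power of
  \<open>d\<close>, while \<open>\<eta>\<close> itself vanishes. The slack \<open>2 \<eta>\<close>
  in the hypotheses yields \<open>\<sigma> < t\<close> but not \<open>\<sigma> t < 1\<close>, since
  \<open>1 / (\<alpha> - 2 \<eta>)\<close> exceeds \<open>1 / \<sigma>\<close>. Relative errors are
  forced by the denominator \<open>ln (pq / p2)\<close>, which is at most about
  \<open>ln (1 / u)\<close>. Conditioning on close pairs costs an absolute amount, affordable only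
  while \<open>ln (1 / u)\<close> is bounded below. For complements the remainder is of order
  \<open>ln (1 / u)\<close> to the power \<open>2 / (1 + \<sigma>) > 1\<close>, hence negligible
  exactly when that logarithm is small. The lower bound on \<open>u\<close> keeps the exponentially
  small mass of near points small relative to \<open>u\<close>.\<close>

definition two_point_mean :: "real \<Rightarrow> real \<Rightarrow> real" where
  "two_point_mean p a = ((1 + a) powr p + (1 - a) powr p) / 2"

text \<open>Raising the exponent loses at \<open>x\<close> and gains at \<open>y\<close>. With
  \<open>k = n - m\<close>, the loss \<open>1 - x powr k\<close> is at most the gain
  \<open>y powr k - 1\<close> because \<open>x * y \<ge> 1\<close>, and the weights satisfy
  \<open>x powr m \<le> 1 \<le> y powr m\<close>.\<close>

lemma powr_sum_mono_exponent:
  fixes x y m n :: real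
  assumes "0 < x" "x \<le> 1" "1 \<le> x * y" "0 \<le> m" "m \<le> n"
  shows "x powr m + y powr m \<le> x powr n + y powr n"
proof -
  have y: "1 \<le> y"
    using assms mult_left_le_one_le[of y x] by (smt (verit) mult_nonneg_nonpos)
  define k where "k = n - m"
  have k: "0 \<le> k" using assms by (simp add: k_def)
  have xn: "x powr n = x powr m * x powr k" and yn: "y powr n = y powr m * y powr k"
    by (simp_all add: k_def flip: powr_add)
  have xk: "x powr k \<le> 1" "0 < x powr k" and xm: "x powr m \<le> 1" and ym: "1 \<le> y powr m"
    and yk: "1 \<le> y powr k"
    using assms y k by (auto intro: powr_le1 ge_one_powr_ge_zero)
  have "1 \<le> (x * y) powr k" using assms k by (intro ge_one_powr_ge_zero) auto
  then have xyk: "1 \<le> x powr k * y powr k" using assms y by (simp add: powr_mult)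
  have "0 \<le> (1 - x powr k) * (y powr k - 1)" using xk yk by simp
  then have "1 - x powr k \<le> y powr k - 1" using xyk by (simp add: algebra_simps)
  moreover have "x powr m * (1 - x powr k) \<le> 1 * (1 - x powr k)"
    using xm xk by (intro mult_right_mono) auto
  moreover have "1 * (y powr k - 1) \<le> y powr m * (y powr k - 1)"
    using ym yk by (intro mult_right_mono) auto
  ultimately show ?thesis unfolding xn yn by (simp add: algebra_simps)
qed

text \<open>Compares the two parts of a derivative below. First the exponent drops from
  \<open>q - 2\<close> to \<open>p - 2\<close> at the point \<open>\<rho> * a\<close>; passing to
  inverses, whose product is at least 1, makes the exponents nonnegative. Then the point moves up to
  \<open>a\<close>, in which the sum is increasing.\<close>

lemma two_point_neg_powr_mono:
  fixes a \<rho> p q :: real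
  assumes "p \<le> q" "q \<le> 2" "0 \<le> a" "a < 1" "0 \<le> \<rho>" "\<rho> \<le> 1"
  shows "(1 + \<rho> * a) powr (q - 2) + (1 - \<rho> * a) powr (q - 2)
       \<le> (1 + a) powr (p - 2) + (1 - a) powr (p - 2)"
proof -
  define b where "b = \<rho> * a"
  have b: "0 \<le> b" "b \<le> a" using assms by (auto simp: b_def mult_left_le_one_le)
  have inv: "x powr (q - 2) = inverse x powr (2 - q)" "x powr (p - 2) = inverse x powr (2 - p)"
    if "0 < x" for x :: real
    using that by (simp_all add: powr_def ln_inverse algebra_simps)
  have b1: "0 < 1 - b" "0 < 1 + b" using b assms by auto
  have "(1 + b) powr (q - 2) + (1 - b) powr (q - 2) \<le> (1 + b) powr (p - 2) + (1 - b) powr (p - 2)"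
    unfolding inv[OF b1(1)] inv[OF b1(2)]
  proof (rule powr_sum_mono_exponent)
    have "(1 + b) * (1 - b) \<le> 1" using b by (simp add: algebra_simps)
    then show "1 \<le> inverse (1 + b) * inverse (1 - b)"
      using b1 by (simp add: one_le_inverse_iff flip: inverse_mult_distrib)
  qed (use assms b b1 in \<open>auto simp: inverse_le_1_iff\<close>)
  also have "\<dots> \<le> (1 + a) powr (p - 2) + (1 - a) powr (p - 2)"
  proof (rule DERIV_nonneg_imp_nondecreasing[of b a "\<lambda>x. (1 + x) powr (p - 2) + (1 - x) powr (p - 2)"])
    fix x assume x: "b \<le> x" "x \<le> a"
    have "((\<lambda>x. (1 + x) powr (p - 2) + (1 - x) powr (p - 2)) has_real_derivative
        (p - 2) * (1 + x) powr (p - 2 - 1) - (p - 2) * (1 - x) powr (p - 2 - 1)) (at x)"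
      using x b assms by (auto intro!: derivative_eq_intros)
    moreover have "(1 + x) powr (p - 2 - 1) \<le> (1 - x) powr (p - 2 - 1)"
      using x b assms by (intro powr_mono2') auto
    then have "0 \<le> (2 - p) * ((1 - x) powr (p - 2 - 1) - (1 + x) powr (p - 2 - 1))"
      using assms by simp
    ultimately show "\<exists>y. ((\<lambda>x. (1 + x) powr (p - 2) + (1 - x) powr (p - 2)) has_real_derivative y) (at x)
        \<and> 0 \<le> y"
      by (intro exI conjI) (auto simp: algebra_simps)
  qed (use b in auto)
  finally show ?thesis unfolding b_def .
qed

text \<open>The factor \<open>p / q\<close> comes from linearizing the power \<open>p / q\<close> in
  the hypercontractive inequality. The difference of the sides vanishes at 0 together with its
  derivative, and the relation between \<open>\<rho>\<close>, \<open>p\<close> and \<open>q\<close>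
  gives both parts of the second derivative the same factor \<open>p - 1\<close>.\<close>

lemma two_point_mean_excess_le:
  fixes a p q \<rho> :: real
  assumes "1 < p" "p \<le> q" "q \<le> 2" "0 \<le> a" "a \<le> 1" "0 \<le> \<rho>" "\<rho>\<^sup>2 * (q - 1) = p - 1"
  shows "p / q * (two_point_mean q (\<rho> * a) - 1) \<le> two_point_mean p a - 1"
proof -
  have \<rho>1: "\<rho> \<le> 1"
  proof (rule ccontr)
    assume "\<not> \<rho> \<le> 1"
    then have "1 < \<rho>\<^sup>2" by (simp add: one_less_power)
    then have "1 * (q - 1) < \<rho>\<^sup>2 * (q - 1)" using assms by (intro mult_strict_right_mono) auto
    then show False using assms by simp
  qed
  \<comment> \<open>\<open>H\<close> is the derivative of the difference \<open>G\<close>, up to the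
    factor \<open>p / 2\<close>.\<close>
  define H where "H x = ((1 + x) powr (p - 1) - (1 - x) powr (p - 1))
      - \<rho> * ((1 + \<rho> * x) powr (q - 1) - (1 - \<rho> * x) powr (q - 1))" for x
  define G where "G x = two_point_mean p x - p / q * two_point_mean q (\<rho> * x)" for x
  have \<rho>x: "\<rho> * x < 1" "0 \<le> \<rho> * x" if "0 \<le> x" "x < 1" for x
    using that \<rho>1 assms mult_left_le_one_le[of x \<rho>] by auto
  have H: "0 \<le> H x" if x: "0 \<le> x" "x < 1" for x
  proof -
    have "H 0 \<le> H x"
    proof (rule DERIV_nonneg_imp_nondecreasing[of 0 x H])
      fix y assume y: "0 \<le> y" "y \<le> x"
      have "(H has_real_derivative
          (p - 1) * ((1 + y) powr (p - 1 - 1) + (1 - y) powr (p - 1 - 1))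
          - \<rho> * (\<rho> * (q - 1) * ((1 + \<rho> * y) powr (q - 1 - 1) + (1 - \<rho> * y) powr (q - 1 - 1)))) (at y)"
        unfolding H_def using y x \<rho>x[of y]
        by (auto intro!: derivative_eq_intros simp: algebra_simps)
      moreover have \<rho>: "\<rho> * (\<rho> * (q - 1) * Z) = (p - 1) * Z" for Z
        unfolding assms(7)[symmetric] by (simp add: power2_eq_square)
      moreover have "0 \<le> (p - 1) * (((1 + y) powr (p - 2) + (1 - y) powr (p - 2))
          - ((1 + \<rho> * y) powr (q - 2) + (1 - \<rho> * y) powr (q - 2)))"
        using two_point_neg_powr_mono[of p q y \<rho>] assms \<rho>1 x y by (intro mult_nonneg_nonneg) auto
      ultimately show "\<exists>z. (H has_real_derivative z) (at y) \<and> 0 \<le> z"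
        unfolding \<rho> by (intro exI conjI) (assumption, simp add: right_diff_distrib)
    qed (use x in auto)
    then show ?thesis by (simp add: H_def)
  qed
  \<comment> \<open>The value \<open>a = 1\<close> is allowed, where the base \<open>1 - x\<close>
    vanishes; so derivatives are taken on the open interval and continuity covers the
    endpoint.\<close>
  have "G 0 \<le> G a"
  proof (rule DERIV_nonneg_imp_increasing_open[of 0 a G])
    fix x assume x: "0 < x" "x < a"
    have "0 \<le> \<rho> * x" "\<rho> * x < 1" using \<rho>x[of x] x assms by auto
    then have "0 < 1 + \<rho> * x" "0 < 1 - \<rho> * x" by linarith+
    then have "(G has_real_derivative p / 2 * H x) (at x)"
      unfolding G_def H_def two_point_mean_def using x assms
      by (auto intro!: derivative_eq_intros simp: field_simps)
    moreover have "0 \<le> p / 2 * H x" using H[of x] x assms by auto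
    ultimately show "\<exists>y. (G has_real_derivative y) (at x) \<and> 0 \<le> y" by blast
  next
    have le: "\<rho> * x \<le> 1" "0 \<le> \<rho> * x" if "x \<in> {0..a}" for x
      using that \<rho>1 assms mult_left_le_one_le[of x \<rho>] by auto
    show "continuous_on {0..a} G"
      unfolding G_def two_point_mean_def using assms le
      by (intro continuous_on_diff continuous_on_mult continuous_on_divide continuous_on_add
          continuous_on_powr' continuous_on_const continuous_on_id)
        (auto simp: add_nonneg_eq_0_iff)
  qed (use assms in auto)
  moreover have "two_point_mean r 0 = 1" for r by (simp add: two_point_mean_def)
  ultimately show ?thesis by (simp add: G_def right_diff_distrib)
qed

lemma powr_le_one_plus:
  fixes x c :: real
  assumes "0 \<le> x" "0 < c" "c \<le> 1"
  shows "x powr c \<le> 1 + c * (x - 1)"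
proof (cases "x = 0")
  case False
  then show ?thesis
    using Youngs_inequality_0[of c "1 - c" x 1] assms by (simp add: algebra_simps)
qed (use assms in auto)

lemma two_point_mean_nonneg: "0 \<le> two_point_mean p a"
  by (simp add: two_point_mean_def)

text \<open>Bonami's inequality for exponents up to 2. The concave power \<open>p / q\<close> lies
  below its tangent at 1, which reduces the claim to the linearized inequality above.\<close>

lemma two_point_hypercontractive:
  fixes a p q \<rho> :: real
  assumes "1 < p" "p \<le> q" "q \<le> 2" "0 \<le> a" "a \<le> 1" "0 \<le> \<rho>" "\<rho>\<^sup>2 * (q - 1) = p - 1"
  shows "two_point_mean q (\<rho> * a) powr (1 / q) \<le> two_point_mean p a powr (1 / p)"
proof -
  have "two_point_mean q (\<rho> * a) powr (p / q) \<le> 1 + p / q * (two_point_mean q (\<rho> * a) - 1)"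
    using assms by (intro powr_le_one_plus two_point_mean_nonneg) auto
  also have "\<dots> \<le> two_point_mean p a"
    using two_point_mean_excess_le[OF assms] by simp
  finally have "(two_point_mean q (\<rho> * a) powr (p / q)) powr (1 / p) \<le> two_point_mean p a powr (1 / p)"
    using assms by (intro powr_mono2) auto
  then show ?thesis using assms by (simp add: powr_powr)
qed

text \<open>Hypercontractivity from \<open>p\<close> to 2 with \<open>\<rho> = sqrt (p - 1)\<close>;
  the mean with exponent 2 is exactly quadratic.\<close>

lemma two_point_mean_ge_sqrt:
  fixes a p :: real
  assumes "1 < p" "p \<le> 2" "0 \<le> a" "a \<le> 1"
  shows "sqrt (1 + (p - 1) * a\<^sup>2) \<le> two_point_mean p a powr (1 / p)"
proof -
  define \<rho> where "\<rho> = sqrt (p - 1)"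
  have r2: "\<rho>\<^sup>2 = p - 1" and r0: "0 \<le> \<rho>" using assms by (auto simp: \<rho>_def)
  have r1: "\<rho> \<le> 1" using assms by (simp add: \<rho>_def)
  have ra: "\<rho> * a \<le> 1" "0 \<le> \<rho> * a" using r1 r0 assms mult_left_le_one_le[of a \<rho>] by auto
  have "two_point_mean 2 (\<rho> * a) = ((1 + \<rho> * a)\<^sup>2 + (1 - \<rho> * a)\<^sup>2) / 2"
    using ra by (cases "\<rho> * a = 1") (auto simp: two_point_mean_def)
  also have "\<dots> = 1 + (p - 1) * a\<^sup>2"
    by (simp add: r2[symmetric] power2_eq_square algebra_simps)
  finally have "two_point_mean 2 (\<rho> * a) = 1 + (p - 1) * a\<^sup>2" .
  moreover have "0 \<le> 1 + (p - 1) * a\<^sup>2" using assms by simp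
  ultimately show ?thesis
    using two_point_hypercontractive[of p 2 a \<rho>] assms r0 r2 by (simp add: powr_half_sqrt)
qed

text \<open>Hoelder's inequality on two points, since \<open>1 + a * b\<close> averages
  \<open>(1 + a) * (1 + b)\<close> and \<open>(1 - a) * (1 - b)\<close>. Young's inequality is
  applied after dividing by the norms \<open>M\<close> and \<open>N\<close>.\<close>

lemma two_point_Holder:
  fixes a b p q :: real
  assumes "1 < p" "1 < q" "1 / p + 1 / q = 1" "0 \<le> a" "a \<le> 1" "0 \<le> b" "b \<le> 1"
  shows "1 + a * b \<le> two_point_mean p a powr (1 / p) * two_point_mean q b powr (1 / q)"
proof -
  have pos: "0 < two_point_mean r c" if "0 \<le> c" "c \<le> 1" for r c
    using that by (auto simp: two_point_mean_def intro!: add_pos_nonneg)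
  define M N where "M = two_point_mean p a powr (1 / p)" and "N = two_point_mean q b powr (1 / q)"
  have M: "0 < M" "M powr p = two_point_mean p a" and N: "0 < N" "N powr q = two_point_mean q b"
    using pos[of a p] pos[of b q] assms by (auto simp: M_def N_def powr_powr)
  have Y: "x / M * (y / N) \<le> x powr p / (p * two_point_mean p a) + y powr q / (q * two_point_mean q b)"
    if "0 \<le> x" "0 \<le> y" for x y
    using Youngs_inequality[of p q "x / M" "y / N"] that assms M N
    by (simp add: powr_divide mult.commute)
  have "(1 + a * b) / (M * N) = ((1 + a) / M * ((1 + b) / N) + (1 - a) / M * ((1 - b) / N)) / 2"
    using M N by (simp add: field_simps)
  also have "\<dots> \<le> (((1 + a) powr p / (p * two_point_mean p a) + (1 + b) powr q / (q * two_point_mean q b))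
      + ((1 - a) powr p / (p * two_point_mean p a) + (1 - b) powr q / (q * two_point_mean q b))) / 2"
    using assms by (intro divide_right_mono add_mono Y) auto
  also have "\<dots> = two_point_mean p a / (p * two_point_mean p a) + two_point_mean q b / (q * two_point_mean q b)"
    unfolding two_point_mean_def by (simp add: add_divide_distrib)
  also have "\<dots> = 1" using pos[of a p] pos[of b q] assms by simp
  finally show ?thesis using M N by (simp add: divide_le_eq M_def N_def)
qed

text \<open>Duality: the conjugate exponent \<open>q\<close> of \<open>s\<close> is below 2, and the
  relation between \<open>r\<close> and \<open>s\<close> becomes the hypercontractive one from
  \<open>r\<close> to \<open>q\<close>. The noise is put on \<open>a\<close>, so Hoelder followed by
  hypercontractivity applies.\<close>

lemma two_point_correlation_le_of_gt_2:
  fixes a b r s \<sigma> :: real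
  assumes "1 < r" "1 < s" "2 < s" "(r - 1) * (s - 1) = \<sigma>\<^sup>2" "0 \<le> \<sigma>" "\<sigma> \<le> 1"
    and "0 \<le> a" "a \<le> 1" "0 \<le> b" "b \<le> 1"
  shows "1 + \<sigma> * a * b \<le> two_point_mean r a powr (1 / r) * two_point_mean s b powr (1 / s)"
proof -
  define q where "q = s / (s - 1)"
  have q: "1 < q" "q \<le> 2" "1 / q + 1 / s = 1" "q - 1 = 1 / (s - 1)"
    using assms by (auto simp: q_def field_simps)
  have "s - 1 \<noteq> 0" using assms by simp
  then have r: "\<sigma>\<^sup>2 * (q - 1) = r - 1"
    unfolding q(4) assms(4)[symmetric] by simp
  have "\<sigma>\<^sup>2 \<le> 1" using assms by (simp add: power_le_one)
  then have "\<sigma>\<^sup>2 * (q - 1) \<le> 1 * (q - 1)" using q(1) by (intro mult_right_mono) auto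
  then have rq: "r \<le> q" using r by simp
  have "1 + \<sigma> * a * b \<le> two_point_mean q (\<sigma> * a) powr (1 / q) * two_point_mean s b powr (1 / s)"
    using two_point_Holder[of q s "\<sigma> * a" b] q assms mult_left_le_one_le[of a \<sigma>] by auto
  also have "\<dots> \<le> two_point_mean r a powr (1 / r) * two_point_mean s b powr (1 / s)"
    using two_point_hypercontractive[of r q a \<sigma>] q r rq assms by (intro mult_right_mono) auto
  finally show ?thesis .
qed

text \<open>If \<open>r\<close> and \<open>s\<close> are both at most 2, the conjugate exponent may
  exceed 2, out of reach of \<open>two_point_hypercontractive\<close>. Then both factors are bounded
  through exponent 2, and Cauchy-Schwarz for \<open>(1, sqrt A)\<close> and
  \<open>(1, sqrt B)\<close> finishes.\<close>

lemma two_point_correlation_le: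
  fixes a b r s \<sigma> :: real
  assumes "1 < r" "1 < s" "(r - 1) * (s - 1) = \<sigma>\<^sup>2" "0 \<le> \<sigma>" "\<sigma> \<le> 1"
    and "0 \<le> a" "a \<le> 1" "0 \<le> b" "b \<le> 1"
  shows "1 + \<sigma> * a * b \<le> two_point_mean r a powr (1 / r) * two_point_mean s b powr (1 / s)"
proof -
  consider "2 < s" | "2 < r" | "r \<le> 2" "s \<le> 2" by linarith
  then show ?thesis
  proof cases
    case 1
    then show ?thesis using two_point_correlation_le_of_gt_2[of r s \<sigma> a b] assms by simp
  next
    case 2
    then show ?thesis using two_point_correlation_le_of_gt_2[of s r \<sigma> b a] assms by (simp add: ac_simps)
  next
    case 3
    define A B where "A = (r - 1) * a\<^sup>2" and "B = (s - 1) * b\<^sup>2"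
    have AB: "0 \<le> A" "0 \<le> B" using assms by (auto simp: A_def B_def)
    have "A * B = (\<sigma> * a * b)\<^sup>2"
      by (simp add: A_def B_def power_mult_distrib flip: assms(3))
    moreover have "2 * (\<sigma> * a * b) \<le> A + B"
    proof -
      have "2 * (\<sigma> * a * b) = 2 * sqrt (A * B)"
        using assms calculation by (simp add: real_sqrt_abs)
      also have "\<dots> \<le> A + B" using arith_geo_mean_sqrt[of A B] AB by simp
      finally show ?thesis .
    qed
    ultimately have "(1 + \<sigma> * a * b)\<^sup>2 \<le> (1 + A) * (1 + B)"
      by (simp add: power2_eq_square algebra_simps)
    then have "1 + \<sigma> * a * b \<le> sqrt ((1 + A) * (1 + B))" by (rule real_le_rsqrt)
    also have "\<dots> = sqrt (1 + A) * sqrt (1 + B)" by (rule real_sqrt_mult)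
    also have "\<dots> \<le> two_point_mean r a powr (1 / r) * two_point_mean s b powr (1 / s)"
      unfolding A_def B_def using 3 assms
      by (intro mult_mono two_point_mean_ge_sqrt) auto
    finally show ?thesis .
  qed
qed

text \<open>Two nonnegative numbers are \<open>m (1 + a)\<close> and \<open>m (1 - a)\<close> for their mean \<open>m\<close>
  and some \<open>a\<close> in \<open>[-1, 1]\<close>; the general two-point inequality is homogeneous in both means.\<close>

lemma two_point_two_function:
  fixes f0 f1 g0 g1 r s \<sigma> :: real
  assumes "1 < r" "1 < s" "(r - 1) * (s - 1) = \<sigma>\<^sup>2" "0 \<le> \<sigma>" "\<sigma> \<le> 1"
    and nn: "0 \<le> f0" "0 \<le> f1" "0 \<le> g0" "0 \<le> g1"
  shows "(1 + \<sigma>) / 4 * (f0 * g0 + f1 * g1) + (1 - \<sigma>) / 4 * (f0 * g1 + f1 * g0)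
    \<le> ((f0 powr r + f1 powr r) / 2) powr (1 / r) * ((g0 powr s + g1 powr s) / 2) powr (1 / s)"
proof -
  have decomp: "\<exists>m a. 0 \<le> m \<and> \<bar>a\<bar> \<le> 1 \<and> x = m * (1 + a) \<and> y = m * (1 - a)"
    if "0 \<le> x" "0 \<le> y" for x y :: real
  proof (cases "x + y = 0")
    case True
    then show ?thesis using that by (intro exI[of _ 0]) auto
  next
    case False
    then show ?thesis using that
      by (intro exI[of _ "(x + y) / 2"] exI[of _ "(x - y) / (x + y)"]) (auto simp: field_simps)
  qed
  obtain m a where m: "0 \<le> m" "\<bar>a\<bar> \<le> 1" and f: "f0 = m * (1 + a)" "f1 = m * (1 - a)"
    using decomp[OF nn(1,2)] by blast
  obtain n b where n: "0 \<le> n" "\<bar>b\<bar> \<le> 1" and g: "g0 = n * (1 + b)" "g1 = n * (1 - b)"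
    using decomp[OF nn(3,4)] by blast
  \<comment> \<open>\<open>two_point_mean\<close> is even in its second argument, hence the absolute
    value.\<close>
  have norm: "((((k * (1 + c)) powr p + (k * (1 - c)) powr p) / 2) powr (1 / p))
      = k * two_point_mean p \<bar>c\<bar> powr (1 / p)"
    if "0 \<le> k" "\<bar>c\<bar> \<le> 1" "1 < p" for k c p :: real
  proof -
    have "((k * (1 + c)) powr p + (k * (1 - c)) powr p) / 2 = k powr p * two_point_mean p \<bar>c\<bar>"
      using that unfolding two_point_mean_def
      by (cases "0 \<le> c") (simp_all add: powr_mult distrib_left[symmetric] del: distrib_left_numeral)
    then show ?thesis using that two_point_mean_nonneg[of p "\<bar>c\<bar>"] by (simp add: powr_mult powr_powr)
  qed
  have "(1 + \<sigma>) / 4 * (f0 * g0 + f1 * g1) + (1 - \<sigma>) / 4 * (f0 * g1 + f1 * g0) = m * n * (1 + \<sigma> * (a * b))"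
    unfolding f g by (simp add: field_simps)
  also have "\<dots> \<le> m * n * (1 + \<sigma> * \<bar>a\<bar> * \<bar>b\<bar>)"
    using m n assms by (intro mult_left_mono) (auto simp: mult.assoc intro!: mult_left_mono simp flip: abs_mult)
  also have "\<dots> \<le> m * n * (two_point_mean r \<bar>a\<bar> powr (1 / r) * two_point_mean s \<bar>b\<bar> powr (1 / s))"
    using m n assms by (intro mult_left_mono two_point_correlation_le) auto
  also have "\<dots> = (m * two_point_mean r \<bar>a\<bar> powr (1 / r)) * (n * two_point_mean s \<bar>b\<bar> powr (1 / s))"
    by simp
  finally show ?thesis unfolding f g norm[OF m assms(1)] norm[OF n assms(2)] .
qed

section \<open>Hypercontractivity and expansion on the cube\<close>

lemma finite_cube [simp]: "finite (cube d)"
  by (simp add: cube_def finite_PiE)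

lemma card_cube: "card (cube d) = 2 ^ d"
  by (simp add: cube_def card_PiE card_insert_if numeral_2_eq_2)

lemma cube_0: "cube 0 = {\<lambda>_. undefined}"
  by (simp add: cube_def)

lemma cube_coord: "x \<in> cube d \<Longrightarrow> i < d \<Longrightarrow> x i = 0 \<or> x i = 1"
  by (auto simp: cube_def PiE_def Pi_def)

lemma sum_cube_Suc:
  fixes f :: "(nat \<Rightarrow> real) \<Rightarrow> real"
  shows "(\<Sum>x\<in>cube (Suc d). f x) = (\<Sum>x\<in>cube d. f (x(d := 0))) + (\<Sum>x\<in>cube d. f (x(d := 1)))"
proof -
  have "cube (Suc d) = (\<lambda>(y, g). g(d := y)) ` ({0, 1} \<times> cube d)"
    unfolding cube_def lessThan_Suc by (rule PiE_insert_eq)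
  moreover have "inj_on (\<lambda>(y, g). g(d := y)) ({0, 1} \<times> cube d)"
    unfolding cube_def by (rule inj_combinator) simp
  ultimately have "(\<Sum>x\<in>cube (Suc d). f x) = (\<Sum>(y, g)\<in>{0, 1} \<times> cube d. f (g(d := y)))"
    by (simp add: sum.reindex case_prod_unfold)
  also have "\<dots> = (\<Sum>x\<in>cube d. f (x(d := 0))) + (\<Sum>x\<in>cube d. f (x(d := 1)))"
    by (simp flip: sum.cartesian_product)
  finally show ?thesis .
qed

text \<open>Transition probability of the noise operator: coordinates flip independently with
  probability \<open>(1 - \<sigma>) / 2\<close>, so a uniform coordinate has correlation
  \<open>\<sigma>\<close> with its copy.\<close>

definition noise_kernel :: "nat \<Rightarrow> real \<Rightarrow> (nat \<Rightarrow> real) \<Rightarrow> (nat \<Rightarrow> real) \<Rightarrow> real" where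
  "noise_kernel d \<sigma> x y = (\<Prod>i<d. if x i = y i then (1 + \<sigma>) / 2 else (1 - \<sigma>) / 2)"

lemma noise_kernel_nonneg: "0 \<le> \<sigma> \<Longrightarrow> \<sigma> \<le> 1 \<Longrightarrow> 0 \<le> noise_kernel d \<sigma> x y"
  unfolding noise_kernel_def by (intro prod_nonneg) auto

lemma noise_kernel_commute: "noise_kernel d \<sigma> x y = noise_kernel d \<sigma> y x"
  unfolding noise_kernel_def by (intro prod.cong) auto

lemma noise_kernel_0: "noise_kernel d 0 x y = 1 / 2 ^ d"
proof -
  have "(if P then (1 + 0) / 2 else (1 - 0) / 2) = (1 / 2 :: real)" for P by simp
  then show ?thesis unfolding noise_kernel_def by (simp only: prod_constant card_lessThan power_one_over)
qed

lemma hamming_dist_commute: "hamming_dist d x y = hamming_dist d y x"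
  by (simp add: hamming_dist_def abs_minus_commute)

lemma noise_kernel_upd:
  "noise_kernel (Suc d) \<sigma> (x(d := a)) (y(d := b))
    = (if a = b then (1 + \<sigma>) / 2 else (1 - \<sigma>) / 2) * noise_kernel d \<sigma> x y"
proof -
  have "(\<Prod>i<d. if (x(d := a)) i = (y(d := b)) i then (1 + \<sigma>) / 2 else (1 - \<sigma>) / 2)
      = noise_kernel d \<sigma> x y"
    unfolding noise_kernel_def by (intro prod.cong) auto
  then show ?thesis by (simp add: noise_kernel_def)
qed

text \<open>The two-function form tensorizes by induction: splitting off the last coordinate leaves
  four slice correlations, each at most a product of slice norms, and the two-point inequality for
  these norms closes the step.\<close>

theorem two_function_hypercontractive:
  fixes f g :: "(nat \<Rightarrow> real) \<Rightarrow> real" and r s \<sigma> :: real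
  assumes "1 < r" "1 < s" "(r - 1) * (s - 1) = \<sigma>\<^sup>2" "0 \<le> \<sigma>" "\<sigma> \<le> 1"
    and "\<And>x. 0 \<le> f x" "\<And>x. 0 \<le> g x"
  shows "(\<Sum>x\<in>cube d. \<Sum>y\<in>cube d. noise_kernel d \<sigma> x y * f x * g y) / 2 ^ d
    \<le> ((\<Sum>x\<in>cube d. f x powr r) / 2 ^ d) powr (1 / r) * ((\<Sum>x\<in>cube d. g x powr s) / 2 ^ d) powr (1 / s)"
  using assms(6,7)
proof (induction d arbitrary: f g)
  case 0
  then show ?case using assms by (simp add: cube_0 noise_kernel_def powr_powr)
next
  case (Suc d)
  define C where "C a b = (\<Sum>x\<in>cube d. \<Sum>y\<in>cube d. noise_kernel d \<sigma> x y * f (x(d := a)) * g (y(d := b))) / 2 ^ d"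
    for a b
  define P where "P a = ((\<Sum>x\<in>cube d. f (x(d := a)) powr r) / 2 ^ d) powr (1 / r)" for a
  define R where "R b = ((\<Sum>x\<in>cube d. g (x(d := b)) powr s) / 2 ^ d) powr (1 / s)" for b
  have CPR: "C a b \<le> P a * R b" for a b
    unfolding C_def P_def R_def by (rule Suc.IH) (use Suc.prems in auto)
  have PR: "0 \<le> P a" "0 \<le> R a" for a by (auto simp: P_def R_def)
  have Pr: "P a powr r = (\<Sum>x\<in>cube d. f (x(d := a)) powr r) / 2 ^ d"
    and Rs: "R a powr s = (\<Sum>x\<in>cube d. g (x(d := a)) powr s) / 2 ^ d" for a
    using assms(1,2) by (auto simp: P_def R_def powr_powr sum_nonneg)
  \<comment> \<open>The last coordinate contributes \<open>(1 + \<sigma>) / 2\<close> or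
    \<open>(1 - \<sigma>) / 2\<close>; the remaining factor \<open>1 / 2\<close> is the change of
    normalization from \<open>2 ^ d\<close> to \<open>2 ^ Suc d\<close>.\<close>
  have block: "(\<Sum>x\<in>cube d. \<Sum>y\<in>cube d. noise_kernel (Suc d) \<sigma> (x(d := a)) (y(d := b)) * f (x(d := a)) * g (y(d := b))) / 2 ^ Suc d
      = (if a = b then (1 + \<sigma>) / 4 else (1 - \<sigma>) / 4) * C a b" for a b
    unfolding noise_kernel_upd C_def
    by (simp add: mult.assoc sum_distrib_left sum_divide_distrib)
  have "(\<Sum>x\<in>cube (Suc d). \<Sum>y\<in>cube (Suc d). noise_kernel (Suc d) \<sigma> x y * f x * g y) / 2 ^ Suc d
      = (1 + \<sigma>) / 4 * (C 0 0 + C 1 1) + (1 - \<sigma>) / 4 * (C 0 1 + C 1 0)"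
    unfolding sum_cube_Suc sum.distrib add_divide_distrib block by (simp add: field_simps)
  also have "\<dots> \<le> (1 + \<sigma>) / 4 * (P 0 * R 0 + P 1 * R 1) + (1 - \<sigma>) / 4 * (P 0 * R 1 + P 1 * R 0)"
    using assms CPR by (intro add_mono mult_left_mono) auto
  also have "\<dots> \<le> ((P 0 powr r + P 1 powr r) / 2) powr (1 / r) * ((R 0 powr s + R 1 powr s) / 2) powr (1 / s)"
    using assms PR by (intro two_point_two_function) auto
  also have "(P 0 powr r + P 1 powr r) / 2 = (\<Sum>x\<in>cube (Suc d). f x powr r) / 2 ^ Suc d"
    unfolding Pr sum_cube_Suc by (simp add: field_simps)
  also have "(R 0 powr s + R 1 powr s) / 2 = (\<Sum>x\<in>cube (Suc d). g x powr s) / 2 ^ Suc d"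
    unfolding Rs sum_cube_Suc by (simp add: field_simps)
  finally show ?case .
qed

definition correlated_prob :: "nat \<Rightarrow> real \<Rightarrow> point_filter \<Rightarrow> point_filter \<Rightarrow> real" where
  "correlated_prob d \<sigma> Q U = (\<Sum>x\<in>cube d. \<Sum>y\<in>cube d. noise_kernel d \<sigma> x y * of_bool (x \<in> Q \<and> y \<in> U)) / 2 ^ d"

text \<open>The exponents stay free because two choices are needed: one adapted to the densities of
  the filters, and \<open>r = s = 1 + \<sigma>\<close> for their complements.\<close>

lemma correlated_prob_le:
  assumes "1 < r" "1 < s" "(r - 1) * (s - 1) = \<sigma>\<^sup>2" "0 \<le> \<sigma>" "\<sigma> \<le> 1"
    and "Q \<subseteq> cube d" "U \<subseteq> cube d"
  shows "correlated_prob d \<sigma> Q U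
    \<le> (real (card Q) / 2 ^ d) powr (1 / r) * (real (card U) / 2 ^ d) powr (1 / s)"
proof -
  have card: "(\<Sum>x\<in>cube d. of_bool (x \<in> A) powr p) = real (card A)" if "A \<subseteq> cube d" for A p
  proof -
    have "(\<Sum>x\<in>cube d. of_bool (x \<in> A) powr p) = (\<Sum>x\<in>cube d. if x \<in> A then 1 else 0)"
      by (intro sum.cong) auto
    also have "\<dots> = real (card A)" using that by (simp add: Int_absorb1 flip: sum.inter_restrict)
    finally show ?thesis .
  qed
  have "correlated_prob d \<sigma> Q U
      = (\<Sum>x\<in>cube d. \<Sum>y\<in>cube d. noise_kernel d \<sigma> x y * of_bool (x \<in> Q) * of_bool (y \<in> U)) / 2 ^ d"
    unfolding correlated_prob_def by (simp add: of_bool_conj mult.assoc)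
  also have "\<dots> \<le> ((\<Sum>x\<in>cube d. of_bool (x \<in> Q) powr r) / 2 ^ d) powr (1 / r)
      * ((\<Sum>x\<in>cube d. of_bool (x \<in> U) powr s) / 2 ^ d) powr (1 / s)"
    by (rule two_function_hypercontractive) (use assms in auto)
  finally show ?thesis using assms by (simp add: card)
qed

text \<open>The exponents \<open>r\<close> and \<open>s\<close> are the optimal ones for sets of density
  \<open>u powr t\<^sup>2\<close> and \<open>u\<close>; the constraint \<open>\<sigma> < t < 1 / \<sigma>\<close> is exactly \<open>r, s > 1\<close>.\<close>

theorem generalized_small_set_expansion:
  fixes t u \<sigma> :: real
  assumes "0 < \<sigma>" "\<sigma> < 1" "\<sigma> < t" "\<sigma> * t < 1" "Q \<subseteq> cube d" "U \<subseteq> cube d"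
    and u: "u = real (card U) / 2 ^ d" and q: "real (card Q) / 2 ^ d = u powr t\<^sup>2"
  shows "correlated_prob d \<sigma> Q U \<le> u powr ((t\<^sup>2 - 2 * \<sigma> * t + 1) / (1 - \<sigma>\<^sup>2))"
proof -
  have s2: "\<sigma>\<^sup>2 < 1" using assms by (simp add: abs_square_less_1)
  define r s where "r = t * (1 - \<sigma>\<^sup>2) / (t - \<sigma>)" and "s = (1 - \<sigma>\<^sup>2) / (1 - \<sigma> * t)"
  have ts: "0 < t - \<sigma>" "0 < 1 - \<sigma> * t" "0 < t" using assms by auto
  have r1: "r - 1 = \<sigma> * (1 - \<sigma> * t) / (t - \<sigma>)" and s1: "s - 1 = \<sigma> * (t - \<sigma>) / (1 - \<sigma> * t)"
    using ts by (simp_all add: r_def s_def field_simps power2_eq_square)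
  have "0 < r - 1" "0 < s - 1" unfolding r1 s1 using ts assms by auto
  then have rs: "1 < r" "1 < s" by auto
  have "(r - 1) * (s - 1) = \<sigma>\<^sup>2" unfolding r1 s1 using ts by (simp add: power2_eq_square)
  then have "correlated_prob d \<sigma> Q U \<le> (u powr t\<^sup>2) powr (1 / r) * u powr (1 / s)"
    using correlated_prob_le[of r s \<sigma> Q d U] rs assms by simp
  also have "\<dots> = u powr (t\<^sup>2 * (1 / r) + 1 / s)" by (simp add: powr_powr powr_add)
  also have "t\<^sup>2 * (1 / r) + 1 / s = (t\<^sup>2 - 2 * \<sigma> * t + 1) / (1 - \<sigma>\<^sup>2)"
  proof -
    have "t\<^sup>2 * (1 / r) = t * (t - \<sigma>) / (1 - \<sigma>\<^sup>2)" "1 / s = (1 - \<sigma> * t) / (1 - \<sigma>\<^sup>2)"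
      using ts s2 by (simp_all add: r_def s_def power2_eq_square)
    then show ?thesis by (simp add: power2_eq_square algebra_simps flip: add_divide_distrib)
  qed
  finally show ?thesis .
qed

section \<open>Exponential moments and tails of the distance under the noise\<close>

lemma sum_noise_kernel_exp_hamming_dist:
  assumes "x \<in> cube d"
  shows "(\<Sum>y\<in>cube d. noise_kernel d \<sigma> x y * exp (h * hamming_dist d x y))
    = ((1 + \<sigma>) / 2 + (1 - \<sigma>) / 2 * exp h) ^ d"
proof -
  define \<phi> where "\<phi> i b = (if x i = b then (1 + \<sigma>) / 2 else (1 - \<sigma>) / 2) * exp (h * \<bar>x i - b\<bar>)" for i b
  have "(\<Sum>y\<in>cube d. noise_kernel d \<sigma> x y * exp (h * hamming_dist d x y)) = (\<Sum>y\<in>cube d. \<Prod>i<d. \<phi> i (y i))"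
    by (simp add: noise_kernel_def hamming_dist_def sum_distrib_left exp_sum \<phi>_def flip: prod.distrib)
  also have "\<dots> = (\<Prod>i<d. \<Sum>b\<in>{0, 1}. \<phi> i b)"
    unfolding cube_def by (rule prod_sum_PiE[symmetric]) auto
  also have "\<dots> = (\<Prod>i<d. (1 + \<sigma>) / 2 + (1 - \<sigma>) / 2 * exp h)"
    using cube_coord[OF assms] by (intro prod.cong) (auto simp: \<phi>_def)
  finally show ?thesis by simp
qed

lemma sum_noise_kernel:
  assumes "x \<in> cube d"
  shows "(\<Sum>y\<in>cube d. noise_kernel d \<sigma> x y) = 1"
  using sum_noise_kernel_exp_hamming_dist[OF assms, of \<sigma> 0] by (simp add: field_simps)

text \<open>Gives the Chernoff bounds their Gaussian exponent, and later the second-order expansion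
  of \<open>u\<close> and \<open>u powr t\<^sup>2\<close> near density 1.\<close>

lemma exp_le_quadratic:
  fixes h :: real
  assumes "\<bar>h\<bar> \<le> 1"
  shows "exp h \<le> 1 + h + h\<^sup>2"
proof (cases "0 \<le> h")
  case True
  then show ?thesis using exp_bound[of h] assms by simp
next
  case False
  define k where "k = - h"
  have k: "0 < k" using False by (simp add: k_def)
  have "1 \<le> 1 + k ^ 3" using k by simp
  also have "\<dots> = (1 - k + k\<^sup>2) * (1 + k)" by (simp add: power2_eq_square power3_eq_cube algebra_simps)
  also have "\<dots> \<le> (1 - k + k\<^sup>2) * exp k"
  proof (rule mult_left_mono)
    have "0 \<le> (1 - k)\<^sup>2 + k" using k by simp
    then show "0 \<le> 1 - k + k\<^sup>2" by (simp add: power2_eq_square algebra_simps)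
  qed simp
  finally have "exp (- k) \<le> 1 - k + k\<^sup>2" by (simp add: exp_minus field_simps)
  then show ?thesis by (simp add: k_def)
qed

lemma sum_noise_kernel_exp_le:
  assumes "x \<in> cube d" "\<bar>h\<bar> \<le> 1" "0 \<le> \<sigma>" "\<sigma> \<le> 1"
  shows "(\<Sum>y\<in>cube d. noise_kernel d \<sigma> x y * exp (h * hamming_dist d x y))
    \<le> exp (real d * ((1 - \<sigma>) / 2 * (h + h\<^sup>2)))"
proof -
  have "(1 + \<sigma>) / 2 + (1 - \<sigma>) / 2 * exp h \<le> (1 + \<sigma>) / 2 + (1 - \<sigma>) / 2 * (1 + h + h\<^sup>2)"
    using exp_le_quadratic[OF assms(2)] assms by (intro add_left_mono mult_left_mono) auto
  also have "\<dots> = 1 + (1 - \<sigma>) / 2 * (h + h\<^sup>2)" by (simp add: field_simps)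
  also have "\<dots> \<le> exp ((1 - \<sigma>) / 2 * (h + h\<^sup>2))" by (rule exp_ge_add_one_self)
  finally have "((1 + \<sigma>) / 2 + (1 - \<sigma>) / 2 * exp h) ^ d \<le> exp ((1 - \<sigma>) / 2 * (h + h\<^sup>2)) ^ d"
    using assms by (intro power_mono) auto
  then show ?thesis
    unfolding sum_noise_kernel_exp_hamming_dist[OF assms(1)] exp_of_nat_mult .
qed

text \<open>Written through the indicator \<open>z\<close> of the flipped coordinates instead of a
  pair of points, so that one number serves every base point.\<close>

definition close_mass :: "nat \<Rightarrow> real \<Rightarrow> real \<Rightarrow> real" where
  "close_mass d \<sigma> r = (\<Sum>z\<in>cube d. (\<Prod>i<d. if z i = 0 then (1 + \<sigma>) / 2 else (1 - \<sigma>) / 2)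
     * of_bool ((\<Sum>i<d. z i) \<le> r))"

text \<open>Coordinatewise difference with \<open>x\<close> is addition modulo 2, an involution of
  the cube that turns \<open>y\<close> into the indicator of the coordinates where it differs from
  \<open>x\<close>.\<close>

lemma sum_noise_kernel_close:
  assumes x: "x \<in> cube d"
  shows "(\<Sum>y\<in>cube d. noise_kernel d \<sigma> x y * of_bool (hamming_dist d x y \<le> r)) = close_mass d \<sigma> r"
proof -
  \<comment> \<open>The restriction keeps the value \<open>undefined\<close> outside
    \<open>{..<d}\<close> that points of the cube must have.\<close>
  define shift where "shift y = restrict (\<lambda>i. \<bar>x i - y i\<bar>) {..<d}" for y :: "nat \<Rightarrow> real"
  have shift: "shift y \<in> cube d" "shift (shift y) = y" if y: "y \<in> cube d" for y
  proof -
    show "shift y \<in> cube d"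
      unfolding shift_def cube_def
    proof (rule restrict_PiE_iff[THEN iffD2], intro ballI)
      fix i assume "i \<in> {..<d}"
      then show "\<bar>x i - y i\<bar> \<in> {0, 1}"
        using cube_coord[OF x, of i] cube_coord[OF y, of i] by auto
    qed
    show "shift (shift y) = y"
    proof
      fix i
      show "shift (shift y) i = y i"
      proof (cases "i < d")
        case True
        then show ?thesis
          using cube_coord[OF x, of i] cube_coord[OF y, of i] by (auto simp: shift_def)
      next
        case False
        then show ?thesis using y by (auto simp: shift_def cube_def PiE_iff extensional_def)
      qed
    qed
  qed
  show ?thesis unfolding close_mass_def
  proof (rule sum.reindex_bij_witness[where i = shift and j = shift])
    fix y assume y: "y \<in> cube d"
    have "(\<Sum>i<d. shift y i) = hamming_dist d x y"
      by (simp add: hamming_dist_def shift_def)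
    moreover have "(\<Prod>i<d. if shift y i = 0 then (1 + \<sigma>) / 2 else (1 - \<sigma>) / 2) = noise_kernel d \<sigma> x y"
      unfolding noise_kernel_def by (intro prod.cong) (auto simp: shift_def)
    ultimately show "(\<Prod>i<d. if shift y i = 0 then (1 + \<sigma>) / 2 else (1 - \<sigma>) / 2)
         * of_bool ((\<Sum>i<d. shift y i) \<le> r) = noise_kernel d \<sigma> x y * of_bool (hamming_dist d x y \<le> r)"
      by simp
  qed (use shift in auto)
qed

lemma cube_nonempty: "\<exists>x. x \<in> cube d"
  by (rule exI[of _ "restrict (\<lambda>_. 0) {..<d}"]) (simp add: cube_def)

lemma one_minus_close_mass:
  assumes "x \<in> cube d"
  shows "(\<Sum>y\<in>cube d. noise_kernel d \<sigma> x y * of_bool (hamming_dist d x y > r)) = 1 - close_mass d \<sigma> r"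
proof -
  have "1 - close_mass d \<sigma> r = (\<Sum>y\<in>cube d. noise_kernel d \<sigma> x y - noise_kernel d \<sigma> x y * of_bool (hamming_dist d x y \<le> r))"
    unfolding sum_subtractf sum_noise_kernel[OF assms] sum_noise_kernel_close[OF assms] ..
  also have "\<dots> = (\<Sum>y\<in>cube d. noise_kernel d \<sigma> x y * of_bool (hamming_dist d x y > r))"
    by (intro sum.cong) auto
  finally show ?thesis by simp
qed

lemma close_mass_nonneg: "0 \<le> \<sigma> \<Longrightarrow> \<sigma> \<le> 1 \<Longrightarrow> 0 \<le> close_mass d \<sigma> r"
  unfolding close_mass_def by (intro sum_nonneg mult_nonneg_nonneg prod_nonneg) auto

text \<open>Chernoff bound: a uniform point has mean distance \<open>d / 2\<close>, and the
  threshold lies \<open>\<beta> d / 2\<close> below it.\<close>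

lemma close_mass_0_le:
  assumes "0 \<le> \<beta>" "\<beta> \<le> 1"
  shows "close_mass d 0 ((1 - \<beta>) * real d / 2) \<le> exp (- (real d * \<beta>\<^sup>2 / 8))"
proof -
  obtain x where x: "x \<in> cube d" using cube_nonempty by blast
  \<comment> \<open>The minimizer of \<open>h\<^sup>2 - \<beta> * h\<close>, the exponent up to the
    factor \<open>d / 2\<close>.\<close>
  define h where "h = \<beta> / 2"
  define r where "r = (1 - \<beta>) * real d / 2"
  have h: "0 \<le> h" "h \<le> 1" using assms by (auto simp: h_def)
  have "close_mass d 0 r = (\<Sum>y\<in>cube d. noise_kernel d 0 x y * of_bool (hamming_dist d x y \<le> r))"
    using sum_noise_kernel_close[OF x] by simp
  also have "\<dots> \<le> (\<Sum>y\<in>cube d. noise_kernel d 0 x y * (exp (h * r) * exp (- h * hamming_dist d x y)))"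
  proof (intro sum_mono mult_left_mono noise_kernel_nonneg)
    show "of_bool (hamming_dist d x y \<le> r) \<le> exp (h * r) * exp (- h * hamming_dist d x y)" for y
      unfolding exp_add[symmetric] using h by (auto simp: mult_left_mono)
  qed auto
  also have "\<dots> = exp (h * r) * (\<Sum>y\<in>cube d. noise_kernel d 0 x y * exp (- h * hamming_dist d x y))"
    unfolding sum_distrib_left by (intro sum.cong) simp_all
  also have "\<dots> \<le> exp (h * r) * exp (real d * ((1 - 0) / 2 * (- h + (- h)\<^sup>2)))"
    using h x by (intro mult_left_mono sum_noise_kernel_exp_le) auto
  also have "\<dots> = exp (- (real d * \<beta>\<^sup>2 / 8))"
    unfolding exp_add[symmetric]
    by (rule arg_cong[where f = exp]) (simp add: h_def r_def power2_eq_square field_simps)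
  finally show ?thesis by (simp add: r_def)
qed

text \<open>At correlation \<open>\<alpha> + \<eta>\<close> the mean distance is
  \<open>(1 - \<alpha> - \<eta>) d / 2\<close>, and the threshold lies \<open>\<eta> d / 2\<close>
  above it.\<close>

lemma one_minus_close_mass_le:
  assumes "0 \<le> \<alpha>" "0 \<le> \<eta>" "\<alpha> + \<eta> \<le> 1"
  shows "1 - close_mass d (\<alpha> + \<eta>) ((1 - \<alpha>) * real d / 2) \<le> exp (- (real d * \<eta>\<^sup>2 / 8))"
proof -
  obtain x where x: "x \<in> cube d" using cube_nonempty by blast
  \<comment> \<open>The minimizer of \<open>h\<^sup>2 - \<eta> * h\<close>, which bounds the
    exponent once the coefficient \<open>1 - (\<alpha> + \<eta>)\<close> of \<open>h\<^sup>2\<close>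
    is replaced by 1.\<close>
  define h where "h = \<eta> / 2"
  define r where "r = (1 - \<alpha>) * real d / 2"
  have h: "0 \<le> h" "h \<le> 1" using assms by (auto simp: h_def)
  have "1 - close_mass d (\<alpha> + \<eta>) r
      = (\<Sum>y\<in>cube d. noise_kernel d (\<alpha> + \<eta>) x y * of_bool (hamming_dist d x y > r))"
    using one_minus_close_mass[OF x] by simp
  also have "\<dots> \<le> (\<Sum>y\<in>cube d. noise_kernel d (\<alpha> + \<eta>) x y * (exp (- h * r) * exp (h * hamming_dist d x y)))"
  proof (intro sum_mono mult_left_mono noise_kernel_nonneg)
    show "of_bool (r < hamming_dist d x y) \<le> exp (- h * r) * exp (h * hamming_dist d x y)" for y
      unfolding exp_add[symmetric] using h by (auto simp: mult_left_mono)
  qed (use assms in auto)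
  also have "\<dots> = exp (- h * r) * (\<Sum>y\<in>cube d. noise_kernel d (\<alpha> + \<eta>) x y * exp (h * hamming_dist d x y))"
    unfolding sum_distrib_left by (intro sum.cong) simp_all
  also have "\<dots> \<le> exp (- h * r) * exp (real d * ((1 - (\<alpha> + \<eta>)) / 2 * (h + h\<^sup>2)))"
    using h x assms by (intro mult_left_mono sum_noise_kernel_exp_le) auto
  also have "\<dots> = exp (real d / 2 * (- \<eta> * h + (1 - (\<alpha> + \<eta>)) * h\<^sup>2))"
    unfolding exp_add[symmetric]
    by (rule arg_cong[where f = exp]) (simp add: r_def power2_eq_square field_simps)
  also have "\<dots> \<le> exp (real d / 2 * (- \<eta> * h + 1 * h\<^sup>2))"
    unfolding exp_le_cancel_iff using assms
    by (intro mult_left_mono add_left_mono mult_right_mono) auto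
  also have "\<dots> = exp (- (real d * \<eta>\<^sup>2 / 8))"
    by (rule arg_cong[where f = exp]) (simp add: h_def power2_eq_square field_simps)
  finally show ?thesis by (simp add: r_def)
qed

section \<open>Regular filter families\<close>

lemma sum_indicator_cube:
  assumes "A \<subseteq> cube d"
  shows "(\<Sum>x\<in>cube d. of_bool (x \<in> A)) = real (card A)"
proof -
  have "(\<Sum>x\<in>cube d. of_bool (x \<in> A)) = (\<Sum>x\<in>cube d. if x \<in> A then 1 else 0 :: real)"
    by (intro sum.cong) auto
  also have "\<dots> = real (card A)" using assms by (simp add: Int_absorb1 flip: sum.inter_restrict)
  finally show ?thesis .
qed

locale regular_filter_family =
  fixes d :: nat and F :: "(point_filter \<times> point_filter) pmf" and r1 r2 p1 p2 pq pu q u :: real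
  assumes family: "filter_family d F"
    and sens: "sensitive d F r1 r2 p1 p2 pq pu"
    and card_query: "\<And>Q U. (Q, U) \<in> set_pmf F \<Longrightarrow> real (card Q) / 2 ^ d = q"
    and card_update: "\<And>Q U. (Q, U) \<in> set_pmf F \<Longrightarrow> real (card U) / 2 ^ d = u"
begin

lemma finite_support: "finite (set_pmf F)"
  using family unfolding filter_family_def by (rule finite_subset) simp

lemma filter_subset:
  assumes "z \<in> set_pmf F"
  shows "fst z \<subseteq> cube d" "snd z \<subseteq> cube d"
  using assms family unfolding filter_family_def by (auto simp: mem_Times_iff dest!: subsetD)

lemma card_fst: "z \<in> set_pmf F \<Longrightarrow> real (card (fst z)) = q * 2 ^ d"
  using card_query[of "fst z" "snd z"] by (simp add: field_simps)

lemma card_snd: "z \<in> set_pmf F \<Longrightarrow> real (card (snd z)) = u * 2 ^ d"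
  using card_update[of "fst z" "snd z"] by (simp add: field_simps)

lemma prob_eq_sum: "measure_pmf.prob F {z. P z} = (\<Sum>z\<in>set_pmf F. pmf F z * of_bool (P z))"
proof -
  have "measure_pmf.prob F {z. P z} = measure_pmf.prob F ({z. P z} \<inter> set_pmf F)"
    by (simp add: measure_Int_set_pmf)
  also have "\<dots> = (\<Sum>z\<in>{z. P z} \<inter> set_pmf F. pmf F z)"
    using finite_support by (simp add: measure_measure_pmf_finite)
  also have "\<dots> = (\<Sum>z\<in>set_pmf F. if P z then pmf F z else 0)"
    using finite_support by (subst Int_commute) (simp add: sum.inter_restrict)
  also have "\<dots> = (\<Sum>z\<in>set_pmf F. pmf F z * of_bool (P z))"
    by (intro sum.cong) auto
  finally show ?thesis .
qed

definition query_prob :: "(nat \<Rightarrow> real) \<Rightarrow> real" where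
  "query_prob x = (\<Sum>z\<in>set_pmf F. pmf F z * of_bool (x \<in> fst z))"

definition update_prob :: "(nat \<Rightarrow> real) \<Rightarrow> real" where
  "update_prob x = (\<Sum>z\<in>set_pmf F. pmf F z * of_bool (x \<in> snd z))"

definition hit_prob :: "(nat \<Rightarrow> real) \<Rightarrow> (nat \<Rightarrow> real) \<Rightarrow> real" where
  "hit_prob x y = (\<Sum>z\<in>set_pmf F. pmf F z * of_bool (x \<in> fst z \<and> y \<in> snd z))"

lemma prob_eq:
  "measure_pmf.prob F {(Q, U). x \<in> Q} = query_prob x"
  "measure_pmf.prob F {(Q, U). x \<in> U} = update_prob x"
  "measure_pmf.prob F {(Q, U). x \<in> Q \<and> y \<in> U} = hit_prob x y"
  unfolding prob_eq_sum query_prob_def update_prob_def hit_prob_def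
  by (simp_all add: case_prod_unfold)

lemma p_order: "0 < p2" "p2 < p1" "p1 < pq" "p1 < pu"
  using sens by (auto simp: sensitive_def)

lemma hit_prob_close: "x \<in> cube d \<Longrightarrow> y \<in> cube d \<Longrightarrow> hamming_dist d x y \<le> r1 \<Longrightarrow> p1 \<le> hit_prob x y"
  and hit_prob_far: "x \<in> cube d \<Longrightarrow> y \<in> cube d \<Longrightarrow> r2 < hamming_dist d x y \<Longrightarrow> hit_prob x y \<le> p2"
  and query_prob_le: "x \<in> cube d \<Longrightarrow> query_prob x \<le> pq"
  and update_prob_le: "x \<in> cube d \<Longrightarrow> update_prob x \<le> pu"
  using sens unfolding sensitive_def prob_eq by blast+

lemma sum_pmf_const: "(\<Sum>z\<in>set_pmf F. pmf F z * B) = B"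
  using finite_support by (simp add: sum_pmf_eq_1 flip: sum_distrib_right)

lemma average_le:
  assumes "\<And>z. z \<in> set_pmf F \<Longrightarrow> h z \<le> B"
  shows "(\<Sum>z\<in>set_pmf F. pmf F z * h z) \<le> B"
proof -
  have "(\<Sum>z\<in>set_pmf F. pmf F z * h z) \<le> (\<Sum>z\<in>set_pmf F. pmf F z * B)"
    using assms by (intro sum_mono mult_left_mono) auto
  then show ?thesis by (simp only: sum_pmf_const)
qed

lemma weighted_sum_swap:
  fixes c :: "'a \<Rightarrow> real"
  shows "(\<Sum>x\<in>A. c x * (\<Sum>z\<in>set_pmf F. pmf F z * h x z))
    = (\<Sum>z\<in>set_pmf F. pmf F z * (\<Sum>x\<in>A. c x * h x z))"
  unfolding sum_distrib_left by (subst sum.swap) (simp add: mult_ac)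

lemma sum_query_prob: "(\<Sum>x\<in>cube d. query_prob x) = q * 2 ^ d"
proof -
  have "(\<Sum>x\<in>cube d. 1 * query_prob x) = (\<Sum>z\<in>set_pmf F. pmf F z * (\<Sum>x\<in>cube d. 1 * of_bool (x \<in> fst z)))"
    unfolding query_prob_def by (rule weighted_sum_swap)
  also have "\<dots> = (\<Sum>z\<in>set_pmf F. pmf F z * (q * 2 ^ d))"
    by (intro sum.cong refl) (simp add: Int_absorb1 filter_subset card_fst)
  finally show ?thesis by (simp add: sum_pmf_const)
qed

lemma sum_update_prob: "(\<Sum>x\<in>cube d. update_prob x) = u * 2 ^ d"
proof -
  have "(\<Sum>x\<in>cube d. 1 * update_prob x) = (\<Sum>z\<in>set_pmf F. pmf F z * (\<Sum>x\<in>cube d. 1 * of_bool (x \<in> snd z)))"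
    unfolding update_prob_def by (rule weighted_sum_swap)
  also have "\<dots> = (\<Sum>z\<in>set_pmf F. pmf F z * (u * 2 ^ d))"
    by (intro sum.cong refl) (simp add: Int_absorb1 filter_subset card_snd)
  finally show ?thesis by (simp add: sum_pmf_const)
qed

lemma query_density_le: "q \<le> pq"
proof -
  have "q * 2 ^ d \<le> (\<Sum>x\<in>cube d. pq)"
    unfolding sum_query_prob[symmetric] by (intro sum_mono query_prob_le)
  then show ?thesis by (simp add: card_cube)
qed

lemma update_density_le: "u \<le> pu"
proof -
  have "u * 2 ^ d \<le> (\<Sum>x\<in>cube d. pu)"
    unfolding sum_update_prob[symmetric] by (intro sum_mono update_prob_le)
  then show ?thesis by (simp add: card_cube)
qed

lemma density_bounds: "0 \<le> q" "q \<le> 1" "0 \<le> u" "u \<le> 1"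
proof -
  obtain z where z: "z \<in> set_pmf F" using set_pmf_not_empty[of F] by blast
  have "card (fst z) \<le> 2 ^ d" "card (snd z) \<le> 2 ^ d"
    using filter_subset[OF z] by (auto simp flip: card_cube intro: card_mono)
  then have "real (card (fst z)) \<le> 2 ^ d" "real (card (snd z)) \<le> 2 ^ d"
    by (metis of_nat_le_iff of_nat_power of_nat_numeral)+
  then show "0 \<le> q" "q \<le> 1" "0 \<le> u" "u \<le> 1"
    using card_query[of "fst z" "snd z"] card_update[of "fst z" "snd z"] z by auto
qed

text \<open>Every point is close to itself, and hitting the pair \<open>(x, x)\<close> puts
  \<open>x\<close> into the query filter. This crude bound covers the range
  \<open>\<sigma> * t \<ge> 1\<close>.\<close>

lemma p1_le_query_density:
  assumes "0 \<le> r1"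
  shows "p1 \<le> q"
proof -
  have "p1 \<le> query_prob x" if "x \<in> cube d" for x
  proof -
    have "p1 \<le> hit_prob x x" using that assms by (intro hit_prob_close) (auto simp: hamming_dist_def)
    also have "\<dots> \<le> query_prob x"
      unfolding hit_prob_def query_prob_def by (intro sum_mono mult_left_mono) auto
    finally show ?thesis .
  qed
  then have "(\<Sum>x\<in>cube d. p1) \<le> q * 2 ^ d"
    unfolding sum_query_prob[symmetric] by (rule sum_mono)
  then show ?thesis by (simp add: card_cube)
qed

text \<open>Close pairs are averaged with noise-kernel weights of total mass
  \<open>close_mass d \<sigma> r1\<close>; each is hit with probability at least \<open>p1\<close>,
  and exchanging sum and expectation leaves a bound for one fixed filter pair. \<open>B\<close> is
  left open to serve both the direct and the complement bound.\<close>

lemma p1_close_mass_le: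
  assumes "0 \<le> \<sigma>" "\<sigma> \<le> 1"
    and "\<And>z. z \<in> set_pmf F \<Longrightarrow> (\<Sum>x\<in>cube d. \<Sum>y\<in>cube d. noise_kernel d \<sigma> x y * of_bool (hamming_dist d x y \<le> r1)
        * of_bool (x \<in> fst z \<and> y \<in> snd z)) / 2 ^ d \<le> B"
  shows "p1 * close_mass d \<sigma> r1 \<le> B"
proof -
  define w where "w = (\<lambda>(x, y). noise_kernel d \<sigma> x y * of_bool (hamming_dist d x y \<le> r1) / 2 ^ d)"
  have w: "0 \<le> w (x, y)" for x y
    unfolding w_def using noise_kernel_nonneg[OF assms(1,2)] by simp
  have "(\<Sum>xy\<in>cube d \<times> cube d. w xy) = (\<Sum>x\<in>cube d. (\<Sum>y\<in>cube d. noise_kernel d \<sigma> x y * of_bool (hamming_dist d x y \<le> r1)) / 2 ^ d)"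
    unfolding w_def sum.cartesian_product' sum_divide_distrib prod.case ..
  also have "\<dots> = close_mass d \<sigma> r1" by (simp add: sum_noise_kernel_close card_cube del: sum_mult_of_bool_eq)
  finally have "p1 * close_mass d \<sigma> r1 = (\<Sum>xy\<in>cube d \<times> cube d. w xy * p1)"
    by (simp add: mult.commute flip: sum_distrib_left)
  also have "\<dots> \<le> (\<Sum>xy\<in>cube d \<times> cube d. w xy * hit_prob (fst xy) (snd xy))"
  proof (intro sum_mono)
    fix xy assume "xy \<in> cube d \<times> cube d"
    then obtain x y where xy: "xy = (x, y)" "x \<in> cube d" "y \<in> cube d" by auto
    show "w xy * p1 \<le> w xy * hit_prob (fst xy) (snd xy)"
    proof (cases "hamming_dist d x y \<le> r1")
      case True
      then show ?thesis using xy hit_prob_close w[of x y] by (simp add: mult_left_mono)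
    next
      case False
      then show ?thesis using xy by (simp add: w_def)
    qed
  qed
  also have "\<dots> = (\<Sum>z\<in>set_pmf F. pmf F z * (\<Sum>xy\<in>cube d \<times> cube d. w xy * of_bool (fst xy \<in> fst z \<and> snd xy \<in> snd z)))"
    unfolding hit_prob_def by (rule weighted_sum_swap)
  also have "\<dots> \<le> B"
  proof (rule average_le)
    fix z assume z: "z \<in> set_pmf F"
    have "(\<Sum>xy\<in>cube d \<times> cube d. w xy * of_bool (fst xy \<in> fst z \<and> snd xy \<in> snd z))
      = (\<Sum>x\<in>cube d. \<Sum>y\<in>cube d. noise_kernel d \<sigma> x y * of_bool (hamming_dist d x y \<le> r1)
        * of_bool (x \<in> fst z \<and> y \<in> snd z)) / 2 ^ d"
      unfolding w_def sum.cartesian_product' sum_divide_distrib prod.case fst_conv snd_conv by simp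
    then show "(\<Sum>xy\<in>cube d \<times> cube d. w xy * of_bool (fst xy \<in> fst z \<and> snd xy \<in> snd z)) \<le> B"
      using assms(3)[OF z] by simp
  qed
  finally show ?thesis .
qed

lemma p1_close_mass_le_expansion:
  assumes "0 < \<sigma>" "\<sigma> < 1" "\<sigma> < t" "\<sigma> * t < 1" "q = u powr t\<^sup>2"
  shows "p1 * close_mass d \<sigma> r1 \<le> u powr ((t\<^sup>2 - 2 * \<sigma> * t + 1) / (1 - \<sigma>\<^sup>2))"
proof (rule p1_close_mass_le)
  fix z assume z: "z \<in> set_pmf F"
  have "(\<Sum>x\<in>cube d. \<Sum>y\<in>cube d. noise_kernel d \<sigma> x y * of_bool (hamming_dist d x y \<le> r1)
        * of_bool (x \<in> fst z \<and> y \<in> snd z)) / 2 ^ d \<le> correlated_prob d \<sigma> (fst z) (snd z)"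
    unfolding correlated_prob_def using assms noise_kernel_nonneg[of \<sigma>]
    by (intro divide_right_mono sum_mono mult_right_mono) (auto simp: mult_left_le)
  also have "\<dots> \<le> u powr ((t\<^sup>2 - 2 * \<sigma> * t + 1) / (1 - \<sigma>\<^sup>2))"
    by (rule generalized_small_set_expansion)
      (use assms z filter_subset card_fst card_snd in auto)
  finally show "(\<Sum>x\<in>cube d. \<Sum>y\<in>cube d. noise_kernel d \<sigma> x y * of_bool (hamming_dist d x y \<le> r1)
        * of_bool (x \<in> fst z \<and> y \<in> snd z)) / 2 ^ d \<le> u powr ((t\<^sup>2 - 2 * \<sigma> * t + 1) / (1 - \<sigma>\<^sup>2))" .
qed (use assms in auto)

text \<open>When the filters are almost the whole cube, the expansion bound drowns in the error term
  caused by conditioning on close pairs. Passing to complements repairs this, because the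
  marginals stay uniform under the conditioning.\<close>

lemma p1_le_complement:
  assumes "0 < \<sigma>" "\<sigma> < 1" "0 < close_mass d \<sigma> r1"
  shows "p1 \<le> q + u - 1 + ((1 - q) * (1 - u)) powr (1 / (1 + \<sigma>)) / close_mass d \<sigma> r1"
proof -
  define c where "c = close_mass d \<sigma> r1"
  define K where "K x y = noise_kernel d \<sigma> x y * of_bool (hamming_dist d x y \<le> r1)" for x y
  have K: "0 \<le> K x y" "K x y \<le> noise_kernel d \<sigma> x y" for x y
    using noise_kernel_nonneg[of \<sigma> d x y] assms by (auto simp: K_def)
  have row: "(\<Sum>y\<in>cube d. K x y) = c" if "x \<in> cube d" for x
    unfolding K_def c_def using that by (rule sum_noise_kernel_close)
  have col: "(\<Sum>x\<in>cube d. K x y) = c" if "y \<in> cube d" for y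
    using row[OF that] unfolding K_def by (simp add: noise_kernel_commute hamming_dist_commute)
  have "p1 * c \<le> c * (q + u - 1) + ((1 - q) * (1 - u)) powr (1 / (1 + \<sigma>))"
    unfolding c_def
  proof (rule p1_close_mass_le)
    fix z assume z: "z \<in> set_pmf F"
    define Q U where "Q = fst z" and "U = snd z"
    have QU: "Q \<subseteq> cube d" "U \<subseteq> cube d" "real (card Q) = q * 2 ^ d" "real (card U) = u * 2 ^ d"
      using filter_subset[OF z] card_fst[OF z] card_snd[OF z] by (auto simp: Q_def U_def)
    have compl: "real (card (cube d - A)) / 2 ^ d = 1 - a" if "A \<subseteq> cube d" "real (card A) = a * 2 ^ d" for A a
    proof -
      have "card A \<le> card (cube d)" using that by (intro card_mono) auto
      then have "real (card (cube d - A)) = real (card (cube d)) - real (card A)"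
        using that by (simp add: card_Diff_subset finite_subset[OF that(1)] of_nat_diff)
      then show ?thesis using that by (simp add: card_cube field_simps)
    qed
    \<comment> \<open>Inclusion-exclusion for the events \<open>x \<in> Q\<close> and
      \<open>y \<in> U\<close>, pointwise under the sum.\<close>
    have "(\<Sum>x\<in>cube d. \<Sum>y\<in>cube d. K x y * of_bool (x \<in> Q \<and> y \<in> U))
        = (\<Sum>x\<in>cube d. \<Sum>y\<in>cube d. K x y * of_bool (x \<in> Q) + K x y * of_bool (y \<in> U) - K x y
            + K x y * of_bool (x \<in> cube d - Q \<and> y \<in> cube d - U))"
      by (intro sum.cong) auto
    also have "\<dots> = (\<Sum>x\<in>cube d. \<Sum>y\<in>cube d. K x y * of_bool (x \<in> Q))
        + (\<Sum>x\<in>cube d. \<Sum>y\<in>cube d. K x y * of_bool (y \<in> U)) - (\<Sum>x\<in>cube d. \<Sum>y\<in>cube d. K x y)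
        + (\<Sum>x\<in>cube d. \<Sum>y\<in>cube d. K x y * of_bool (x \<in> cube d - Q \<and> y \<in> cube d - U))"
      by (simp add: sum.distrib sum_subtractf)
    also have "(\<Sum>x\<in>cube d. \<Sum>y\<in>cube d. K x y * of_bool (x \<in> Q)) = c * (q * 2 ^ d)"
      unfolding QU(3)[symmetric] sum_indicator_cube[OF QU(1), symmetric] sum_distrib_left
      by (intro sum.cong refl) (simp only: row flip: sum_distrib_right)
    also have "(\<Sum>x\<in>cube d. \<Sum>y\<in>cube d. K x y * of_bool (y \<in> U)) = c * (u * 2 ^ d)"
      unfolding QU(4)[symmetric] sum_indicator_cube[OF QU(2), symmetric] sum_distrib_left
      by (subst sum.swap, intro sum.cong refl) (simp only: col flip: sum_distrib_right)
    also have "(\<Sum>x\<in>cube d. \<Sum>y\<in>cube d. K x y) = c * 2 ^ d"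
      by (simp add: row card_cube)
    finally have "(\<Sum>x\<in>cube d. \<Sum>y\<in>cube d. K x y * of_bool (x \<in> Q \<and> y \<in> U)) / 2 ^ d
        = c * (q + u - 1) + (\<Sum>x\<in>cube d. \<Sum>y\<in>cube d. K x y * of_bool (x \<in> cube d - Q \<and> y \<in> cube d - U)) / 2 ^ d"
      by (simp add: field_simps)
    also have "\<dots> \<le> c * (q + u - 1) + correlated_prob d \<sigma> (cube d - Q) (cube d - U)"
      unfolding correlated_prob_def using K
      by (intro add_left_mono divide_right_mono sum_mono mult_right_mono) auto
    \<comment> \<open>The symmetric exponents \<open>r = s = 1 + \<sigma>\<close>; near density 1
      they already give a remainder of higher order.\<close>
    also have "correlated_prob d \<sigma> (cube d - Q) (cube d - U)
        \<le> (real (card (cube d - Q)) / 2 ^ d) powr (1 / (1 + \<sigma>)) * (real (card (cube d - U)) / 2 ^ d) powr (1 / (1 + \<sigma>))"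
      using assms by (intro correlated_prob_le) (auto simp: power2_eq_square)
    also have "\<dots> = ((1 - q) * (1 - u)) powr (1 / (1 + \<sigma>))"
      using QU density_bounds by (simp add: compl powr_mult)
    finally show "(\<Sum>x\<in>cube d. \<Sum>y\<in>cube d. noise_kernel d \<sigma> x y * of_bool (hamming_dist d x y \<le> r1)
          * of_bool (x \<in> fst z \<and> y \<in> snd z)) / 2 ^ d
        \<le> close_mass d \<sigma> r1 * (q + u - 1) + ((1 - q) * (1 - u)) powr (1 / (1 + \<sigma>))"
      by (simp add: K_def Q_def U_def c_def)
  qed (use assms in auto)
  then show ?thesis using assms(3) unfolding c_def[symmetric] by (simp add: field_simps)
qed

text \<open>The cube is finite, so if no point reached \<open>pq\<close>, a smaller value would
  still make the family sensitive.\<close>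

lemma minimal_pq_attained:
  assumes "minimal_pq d F r1 r2 p1 p2 pq pu"
  shows "\<exists>x\<in>cube d. query_prob x = pq"
proof (rule ccontr)
  assume "\<not> ?thesis"
  then have less: "query_prob x < pq" if "x \<in> cube d" for x
    using query_prob_le[OF that] that by force
  define m where "m = Max (query_prob ` cube d)"
  have ne: "query_prob ` cube d \<noteq> {}" using cube_nonempty by blast
  have m: "m < pq" unfolding m_def using ne less by (subst Max_less_iff) auto
  \<comment> \<open>Sensitivity also demands \<open>p1 < pq'\<close>, hence the midpoint beside the
    maximum \<open>m\<close>.\<close>
  define pq' where "pq' = max m ((p1 + pq) / 2)"
  have "sensitive d F r1 r2 p1 p2 pq' pu"
  proof -
    have "query_prob x \<le> pq'" if "x \<in> cube d" for x
      using that by (auto simp: pq'_def m_def le_max_iff_disj)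
    moreover have "p1 < pq'" using p_order by (auto simp: pq'_def less_max_iff_disj)
    ultimately show ?thesis
      unfolding sensitive_def prob_eq
      using p_order hit_prob_close hit_prob_far update_prob_le by blast
  qed
  then have "pq \<le> pq'" using assms by (auto simp: minimal_pq_def)
  then show False using m p_order by (auto simp: pq'_def max_def split: if_splits)
qed

text \<open>Averaging over the far points from a point attaining \<open>pq\<close> bounds \<open>p2\<close> in terms of
  \<open>pq\<close> itself rather than the possibly smaller query density \<open>q\<close>.\<close>

lemma p2_ge:
  assumes "minimal_pq d F r1 r2 p1 p2 pq pu"
  shows "pq * (u - close_mass d 0 r2) \<le> p2 * (1 - close_mass d 0 r2)"
proof -
  obtain x where x: "x \<in> cube d" "query_prob x = pq" using minimal_pq_attained[OF assms] by blast
  define T where "T = close_mass d 0 r2"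
  define w where "w y = noise_kernel d 0 x y * of_bool (hamming_dist d x y > r2)" for y
  have w: "0 \<le> w y" for y by (simp add: w_def noise_kernel_nonneg)
  have sw: "(\<Sum>y\<in>cube d. w y) = 1 - T" unfolding w_def T_def by (rule one_minus_close_mass[OF x(1)])
  \<comment> \<open>At \<open>\<sigma> = 0\<close> the kernel is uniform: the update filter has mass
    \<open>u\<close>, of which at most \<open>T\<close> lies within distance \<open>r2\<close> of
    \<open>x\<close>.\<close>
  have far: "of_bool (x \<in> fst z) * (u - T) \<le> (\<Sum>y\<in>cube d. w y * of_bool (x \<in> fst z \<and> y \<in> snd z))"
    if z: "z \<in> set_pmf F" for z
  proof -
    have "(\<Sum>y\<in>cube d. noise_kernel d 0 x y * of_bool (y \<in> snd z)) = u"
      unfolding noise_kernel_0 sum_distrib_left[symmetric] sum_indicator_cube[OF filter_subset(2)[OF z]]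
      by (simp add: card_snd[OF z])
    then have "u - T = (\<Sum>y\<in>cube d. noise_kernel d 0 x y * of_bool (y \<in> snd z)
        - noise_kernel d 0 x y * of_bool (hamming_dist d x y \<le> r2))"
      unfolding sum_subtractf sum_noise_kernel_close[OF x(1)] T_def by (simp only:)
    also have "\<dots> \<le> (\<Sum>y\<in>cube d. w y * of_bool (y \<in> snd z))"
      by (intro sum_mono) (auto simp: w_def noise_kernel_0)
    finally show ?thesis by auto
  qed
  have "pq * (u - T) = (\<Sum>z\<in>set_pmf F. pmf F z * (of_bool (x \<in> fst z) * (u - T)))"
    unfolding x(2)[symmetric] query_prob_def sum_distrib_right by (simp add: mult_ac)
  also have "\<dots> \<le> (\<Sum>z\<in>set_pmf F. pmf F z * (\<Sum>y\<in>cube d. w y * of_bool (x \<in> fst z \<and> y \<in> snd z)))"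
    using far by (intro sum_mono mult_left_mono) auto
  also have "\<dots> = (\<Sum>y\<in>cube d. w y * hit_prob x y)"
    unfolding hit_prob_def by (rule weighted_sum_swap[symmetric])
  also have "\<dots> \<le> (\<Sum>y\<in>cube d. w y * p2)"
  proof (intro sum_mono)
    fix y assume y: "y \<in> cube d"
    show "w y * hit_prob x y \<le> w y * p2"
      using hit_prob_far[OF x(1) y] w[of y] by (cases "r2 < hamming_dist d x y") (auto simp: mult_left_mono w_def)
  qed
  also have "\<dots> = p2 * (1 - T)" by (simp add: sw mult.commute flip: sum_distrib_left)
  finally show ?thesis unfolding T_def .
qed

text \<open>For \<open>u = 1\<close>, \<open>p2_ge\<close> would force \<open>pq \<le> p2\<close>.
  Hence \<open>- ln u\<close>, the unit in which errors are measured, is positive.\<close>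

lemma update_density_less_1:
  assumes "minimal_pq d F r1 r2 p1 p2 pq pu" "close_mass d 0 r2 < 1"
  shows "u < 1"
proof (rule ccontr)
  assume "\<not> u < 1"
  then have "u = 1" using density_bounds by simp
  then show False using p2_ge[OF assms(1)] assms(2) p_order by simp
qed

text \<open>With \<open>T\<close> for the close mass, \<open>p2_ge\<close> gives
  \<open>pq / p2 \<le> (1 - T) / (u - T)\<close>. Keeping \<open>1 - T\<close> in the numerator
  yields a correction with factor \<open>1 - u \<le> - ln u\<close>, so the error stays relative as
  \<open>u\<close> tends to 1.\<close>

lemma ln_pq_p2_le:
  assumes "minimal_pq d F r1 r2 p1 p2 pq pu" "close_mass d 0 r2 < u"
  shows "ln (pq / p2) \<le> (1 + close_mass d 0 r2 / (u - close_mass d 0 r2)) * - ln u"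
proof -
  define T where "T = close_mass d 0 r2"
  have T: "0 \<le> T" "T < u" using close_mass_nonneg[of 0] assms by (auto simp: T_def)
  then have u: "0 < u" by simp
  have "pq / p2 \<le> (1 - T) / (u - T)"
    using p2_ge[OF assms(1)] T p_order unfolding T_def[symmetric] by (simp add: field_simps)
  also have "\<dots> = (1 / u) * (1 + T * (1 - u) / (u - T))"
    using T u by (simp add: field_simps)
  finally have "ln (pq / p2) \<le> ln ((1 / u) * (1 + T * (1 - u) / (u - T)))"
    using p_order by (intro ln_mono) auto
  also have "\<dots> = - ln u + ln (1 + T * (1 - u) / (u - T))"
  proof -
    have "0 \<le> T * (1 - u) / (u - T)" using T density_bounds by simp
    then show ?thesis using u by (subst ln_mult) (auto simp: ln_div)
  qed
  also have "\<dots> \<le> - ln u + T * (1 - u) / (u - T)"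
    using T density_bounds by (intro add_left_mono ln_add_one_self_le_self) auto
  also have "\<dots> \<le> - ln u + T * (- ln u) / (u - T)"
    using T ln_le_minus_one[OF u] by (intro add_left_mono divide_right_mono mult_left_mono) auto
  also have "\<dots> = (1 + T / (u - T)) * - ln u" by (simp add: algebra_simps)
  finally show ?thesis unfolding T_def .
qed

end

section \<open>The exponents\<close>

text \<open>The two bounds on \<open>t\<close> put \<open>\<alpha> * t\<close> within
  \<open>\<delta> / \<alpha>\<close> of 1, so the squared term costs at most \<open>e\<close> and
  the crude bound on \<open>p\<close> is enough.\<close>

lemma exponent_le_boundary:
  fixes \<alpha> \<sigma> t u p \<delta> e :: real
  assumes "0 < \<alpha>" "\<alpha> < 1" "\<alpha> < \<sigma>" "\<sigma> \<le> \<alpha> + \<delta>" "1 \<le> \<sigma> * t" "t \<le> 1 / \<alpha> + \<delta>"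
    and "(\<delta> / \<alpha>)\<^sup>2 \<le> e * (1 - \<alpha>\<^sup>2)" and u: "0 < u" "u < 1" and p: "0 < p" "p \<le> u powr t\<^sup>2"
  shows "((1 - \<alpha> * t)\<^sup>2 / (1 - \<alpha>\<^sup>2) + t\<^sup>2 - e) * - ln u \<le> - ln p"
proof -
  have d: "0 < \<delta>" using assms by linarith
  have a2: "\<alpha>\<^sup>2 < 1" using assms by (simp add: abs_square_less_1)
  have "1 / \<sigma> \<le> t" using assms by (simp add: divide_le_eq mult.commute)
  then have "\<alpha> * (1 / \<sigma>) \<le> \<alpha> * t" using assms by (intro mult_left_mono) auto
  moreover have "1 - \<alpha> * (1 / \<sigma>) = (\<sigma> - \<alpha>) / \<sigma>" using assms by (simp add: field_simps)
  moreover have "(\<sigma> - \<alpha>) / \<sigma> \<le> \<delta> / \<alpha>" using assms d by (intro frac_le) auto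
  ultimately have 1: "1 - \<alpha> * t \<le> \<delta> / \<alpha>" by linarith
  have "\<alpha> * t \<le> \<alpha> * (1 / \<alpha> + \<delta>)" using assms by (intro mult_left_mono) auto
  also have "\<dots> = 1 + \<alpha> * \<delta>" using assms by (simp add: field_simps)
  also have "\<alpha> * \<delta> \<le> \<delta> / \<alpha>"
  proof -
    have "\<alpha>\<^sup>2 * \<delta> \<le> 1 * \<delta>" using a2 d by (intro mult_right_mono) auto
    then show ?thesis using assms by (simp add: field_simps power2_eq_square)
  qed
  finally have 2: "\<alpha> * t \<le> 1 + \<delta> / \<alpha>" by simp
  have "\<bar>1 - \<alpha> * t\<bar> \<le> \<bar>\<delta> / \<alpha>\<bar>" using 1 2 by linarith
  then have "(1 - \<alpha> * t)\<^sup>2 \<le> e * (1 - \<alpha>\<^sup>2)"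
    using assms(7) by (simp only: abs_le_square_iff)
  then have "(1 - \<alpha> * t)\<^sup>2 / (1 - \<alpha>\<^sup>2) \<le> e" using a2 by (simp add: divide_le_eq)
  then have "((1 - \<alpha> * t)\<^sup>2 / (1 - \<alpha>\<^sup>2) + t\<^sup>2 - e) * - ln u \<le> t\<^sup>2 * - ln u"
    using u by (intro mult_right_mono) auto
  also have "\<dots> \<le> - ln p" using p u ln_mono[of p "u powr t\<^sup>2"] by (simp add: ln_powr)
  finally show ?thesis .
qed

text \<open>Half of \<open>e\<close> pays for replacing \<open>\<sigma>\<close> by
  \<open>\<alpha>\<close> in the square, the other half for the conditioning loss
  \<open>- ln c \<le> 2 * \<delta>\<close>. The latter is absolute, hence the lower bound
  \<open>L\<close> on \<open>- ln u\<close>.\<close>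

lemma exponent_le_expansion:
  fixes \<alpha> \<sigma> t \<tau> u p c \<delta> e L :: real
  assumes "0 < \<alpha>" "\<alpha> < \<sigma>" "\<sigma> \<le> \<alpha> + \<delta>" "\<sigma> < 1" "\<sigma> < t" "t \<le> \<tau>" "\<delta> \<le> 1 / 2" "1 - \<delta> \<le> c"
    and "2 * \<delta> * \<tau> \<le> e / 2 * (1 - \<alpha>\<^sup>2)" "2 * \<delta> \<le> e / 2 * L" "0 < e"
    and u: "0 < u" "u < 1" "L \<le> - ln u"
    and p: "0 < p" "p * c \<le> u powr ((t\<^sup>2 - 2 * \<sigma> * t + 1) / (1 - \<sigma>\<^sup>2))"
  shows "((1 - \<alpha> * t)\<^sup>2 / (1 - \<alpha>\<^sup>2) + t\<^sup>2 - e) * - ln u \<le> - ln p"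
proof -
  define N where "N = - ln u"
  define A where "A = (1 - \<alpha> * t)\<^sup>2"
  define S where "S = (1 - \<sigma> * t)\<^sup>2"
  have d: "0 < \<delta>" using assms by linarith
  have s2: "\<sigma>\<^sup>2 < 1" "\<alpha>\<^sup>2 < \<sigma>\<^sup>2" using assms by (auto simp: abs_square_less_1 intro!: power_strict_mono)
  have t: "0 < t" using assms by linarith
  have N: "L \<le> N" "0 < N" using u by (auto simp: N_def)
  have c: "0 < c" using assms by linarith
  \<comment> \<open>Completing the square separates \<open>t\<^sup>2\<close>, the share of the query
    density, from the term to be compared with its value at \<open>\<alpha>\<close>.\<close>
  have "(t\<^sup>2 - 2 * \<sigma> * t + 1) = t\<^sup>2 * (1 - \<sigma>\<^sup>2) + S"
    by (simp add: S_def power2_eq_square algebra_simps)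
  then have E: "(t\<^sup>2 - 2 * \<sigma> * t + 1) / (1 - \<sigma>\<^sup>2) = t\<^sup>2 + S / (1 - \<sigma>\<^sup>2)"
    using s2 by (simp add: add_divide_distrib)
  have "A - S = (\<sigma> - \<alpha>) * t * (2 - (\<alpha> + \<sigma>) * t)"
    by (simp add: A_def S_def power2_eq_square algebra_simps)
  also have "\<dots> \<le> (\<sigma> - \<alpha>) * t * 2" using assms t by (intro mult_left_mono) auto
  also have "\<dots> \<le> \<delta> * \<tau> * 2" using assms t d by (intro mult_right_mono mult_mono) auto
  finally have AS: "A - S \<le> e / 2 * (1 - \<alpha>\<^sup>2)" using assms(9) by simp
  have "A / (1 - \<alpha>\<^sup>2) - e / 2 = (A - e / 2 * (1 - \<alpha>\<^sup>2)) / (1 - \<alpha>\<^sup>2)"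
    using s2 by (simp add: field_simps)
  also have "\<dots> \<le> S / (1 - \<alpha>\<^sup>2)" using AS s2 by (intro divide_right_mono) auto
  also have "\<dots> \<le> S / (1 - \<sigma>\<^sup>2)" using s2 by (intro divide_left_mono mult_pos_pos) (auto simp: S_def)
  finally have "(A / (1 - \<alpha>\<^sup>2) + t\<^sup>2 - e / 2) * N \<le> (t\<^sup>2 + S / (1 - \<sigma>\<^sup>2)) * N"
    using N by (intro mult_right_mono) auto
  moreover have "ln p + ln c \<le> (t\<^sup>2 + S / (1 - \<sigma>\<^sup>2)) * ln u"
    using ln_mono[OF p(2)] p(1) c u unfolding E by (simp add: ln_mult ln_powr)
  moreover have "- 2 * \<delta> \<le> ln c"
  proof -
    have "\<delta> * \<delta> \<le> \<delta> * (1 / 2)" using assms d by (intro mult_left_mono) auto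
    then have "- 2 * \<delta> \<le> - \<delta> - 2 * \<delta>\<^sup>2" by (simp add: power2_eq_square)
    also have "\<dots> \<le> ln (1 - \<delta>)" using assms d by (intro ln_one_minus_pos_lower_bound) auto
    also have "\<dots> \<le> ln c" using assms by (intro ln_mono) auto
    finally show ?thesis .
  qed
  moreover have "2 * \<delta> \<le> e / 2 * N"
    using assms(10) mult_left_mono[OF N(1), of "e / 2"] assms(11) by linarith
  moreover have "(A / (1 - \<alpha>\<^sup>2) + t\<^sup>2 - e / 2) * N = (A / (1 - \<alpha>\<^sup>2) + t\<^sup>2 - e) * N + e / 2 * N"
    by (simp add: algebra_simps)
  ultimately show ?thesis by (simp add: N_def A_def)
qed

text \<open>To first order in \<open>L\<close> the bound on \<open>p\<close> is
  \<open>1 - (1 + t\<^sup>2) * L\<close>, with remainder at most \<open>e * L\<close>. The resulting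
  coefficient \<open>1 + t\<^sup>2\<close> suffices because
  \<open>(1 - \<alpha> * t)\<^sup>2 / (1 - \<alpha>\<^sup>2) \<le> 1\<close>.\<close>

lemma exponent_le_complement:
  fixes \<alpha> \<sigma> t \<tau> u p c e \<kappa> :: real
  assumes "0 < \<sigma>" "\<sigma> \<le> (1 + \<alpha>) / 2" "\<alpha> < 1" "0 < \<alpha>" "0 < t" "t \<le> \<tau>" "1 \<le> \<tau>" "1 / 2 \<le> c"
    and \<kappa>: "\<kappa> = (1 - \<alpha>) / 4" and Cq: "(1 - \<alpha> * t)\<^sup>2 \<le> 1 - \<alpha>\<^sup>2"
    and u: "0 < u" "u < 1" and L: "L = - ln u" "\<tau>\<^sup>2 * L \<le> 1" "(\<tau>\<^sup>2 + 1)\<^sup>2 * L powr \<kappa> \<le> e"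
    and p: "0 < p" "p \<le> u powr t\<^sup>2 + u - 1 + ((1 - u powr t\<^sup>2) * (1 - u)) powr (1 / (1 + \<sigma>)) / c"
  shows "((1 - \<alpha> * t)\<^sup>2 / (1 - \<alpha>\<^sup>2) + t\<^sup>2 - e) * - ln u \<le> - ln p"
proof -
  have \<tau>2: "1 \<le> \<tau>\<^sup>2" using assms by simp
  have L0: "0 < L" using u L by simp
  have L1: "L \<le> 1" using mult_right_mono[OF \<tau>2, of L] L0 L(2) by linarith
  have a2: "\<alpha>\<^sup>2 < 1" using assms by (simp add: abs_square_less_1)
  have t2: "t\<^sup>2 \<le> \<tau>\<^sup>2" using assms by (intro power_mono) auto
  have tL: "t\<^sup>2 * L \<le> \<tau>\<^sup>2 * L" using t2 L0 by (intro mult_right_mono) auto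
  have ue: "u = exp (- L)" using u L by simp
  have qe: "u powr t\<^sup>2 = exp (- (t\<^sup>2 * L))" using u L by (simp add: powr_def)
  have u_up: "1 - u \<le> L" unfolding ue using exp_ge_add_one_self[of "- L"] by simp
  have q_up: "1 - u powr t\<^sup>2 \<le> t\<^sup>2 * L" unfolding qe using exp_ge_add_one_self[of "- (t\<^sup>2 * L)"] by simp
  have u_lo: "u \<le> 1 - L + L\<^sup>2" unfolding ue using exp_le_quadratic[of "- L"] L0 L1 by simp
  have q_lo: "u powr t\<^sup>2 \<le> 1 - t\<^sup>2 * L + (t\<^sup>2 * L)\<^sup>2"
    unfolding qe using exp_le_quadratic[of "- (t\<^sup>2 * L)"] L0 L(2) tL by simp
  have q1: "u powr t\<^sup>2 \<le> 1" using u by (intro powr_le1) auto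
  define R where "R = ((1 - u powr t\<^sup>2) * (1 - u)) powr (1 / (1 + \<sigma>))"
  have "R \<le> (\<tau>\<^sup>2 * L\<^sup>2) powr (1 / (1 + \<sigma>))"
    unfolding R_def
  proof (rule powr_mono2)
    have "(1 - u powr t\<^sup>2) * (1 - u) \<le> (\<tau>\<^sup>2 * L) * L"
      using order.trans[OF q_up tL] u_up q1 u L0 by (intro mult_mono) auto
    then show "(1 - u powr t\<^sup>2) * (1 - u) \<le> \<tau>\<^sup>2 * L\<^sup>2" by (simp add: power2_eq_square mult.assoc)
  qed (use q1 u assms in auto)
  also have "\<dots> = (\<tau>\<^sup>2) powr (1 / (1 + \<sigma>)) * (L\<^sup>2) powr (1 / (1 + \<sigma>))" by (simp add: powr_mult)
  also have "\<dots> \<le> \<tau>\<^sup>2 * L powr (1 + \<kappa>)"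
  proof (intro mult_mono)
    show "(\<tau>\<^sup>2) powr (1 / (1 + \<sigma>)) \<le> \<tau>\<^sup>2"
      using powr_mono[of "1 / (1 + \<sigma>)" 1 "\<tau>\<^sup>2"] \<tau>2 assms by simp
    \<comment> \<open>\<open>\<kappa>\<close> is chosen so that
      \<open>2 / (1 + \<sigma>) \<ge> 1 + \<kappa>\<close> whenever
      \<open>\<sigma> \<le> (1 + \<alpha>) / 2\<close>: a power of \<open>L\<close> above 1 is small
      against \<open>L\<close>.\<close>
    have "(1 + \<kappa>) * (1 + \<sigma>) \<le> 2"
    proof -
      have "(1 + \<kappa>) * (1 + \<sigma>) \<le> (1 + \<kappa>) * (1 + (1 + \<alpha>) / 2)"
        using assms by (intro mult_left_mono) auto
      also have "\<dots> = 2 - (1 - \<alpha>)\<^sup>2 / 8"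
        unfolding \<kappa> by (simp add: field_simps power2_eq_square)
      also have "\<dots> \<le> 2" by simp
      finally show ?thesis .
    qed
    then have "1 + \<kappa> \<le> 2 / (1 + \<sigma>)" using assms(1) by (simp add: le_divide_eq)
    then have "L powr (2 / (1 + \<sigma>)) \<le> L powr (1 + \<kappa>)" using L0 L1 by (intro powr_mono') auto
    moreover have "L\<^sup>2 = L powr 2" using L0 by simp
    ultimately show "(L\<^sup>2) powr (1 / (1 + \<sigma>)) \<le> L powr (1 + \<kappa>)" by (simp add: powr_powr)
  qed auto
  also have "\<dots> = \<tau>\<^sup>2 * (L powr \<kappa> * L)" using L0 by (simp add: powr_add)
  finally have R: "R \<le> \<tau>\<^sup>2 * (L powr \<kappa> * L)" .
  have R0: "0 \<le> R" by (simp add: R_def)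
  have "R / c \<le> R / (1 / 2)" using R0 assms by (intro divide_left_mono) auto
  with R have Rc: "R / c \<le> 2 * \<tau>\<^sup>2 * (L powr \<kappa> * L)" by simp
  have LL: "L\<^sup>2 \<le> L powr \<kappa> * L"
  proof -
    have "L powr 1 \<le> L powr \<kappa>" using L0 L1 assms by (intro powr_mono') auto
    then show ?thesis using L0 by (simp add: power2_eq_square)
  qed
  have "(t\<^sup>2 * L)\<^sup>2 \<le> (\<tau>\<^sup>2)\<^sup>2 * L\<^sup>2"
    unfolding power_mult_distrib by (intro mult_right_mono power_mono[OF t2]) auto
  also have "\<dots> \<le> (\<tau>\<^sup>2)\<^sup>2 * (L powr \<kappa> * L)" using LL by (intro mult_left_mono) auto
  finally have tt: "(t\<^sup>2 * L)\<^sup>2 \<le> (\<tau>\<^sup>2)\<^sup>2 * (L powr \<kappa> * L)" .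
  have err: "L\<^sup>2 + (t\<^sup>2 * L)\<^sup>2 + R / c \<le> e * L"
  proof -
    have "L\<^sup>2 + (t\<^sup>2 * L)\<^sup>2 + R / c
        \<le> L powr \<kappa> * L + (\<tau>\<^sup>2)\<^sup>2 * (L powr \<kappa> * L) + 2 * \<tau>\<^sup>2 * (L powr \<kappa> * L)"
      using LL tt Rc by linarith
    also have "\<dots> = ((\<tau>\<^sup>2 + 1)\<^sup>2 * L powr \<kappa>) * L" by (simp add: power2_eq_square algebra_simps)
    also have "\<dots> \<le> e * L" using L(3) L0 by (intro mult_right_mono) auto
    finally show ?thesis .
  qed
  have "(1 - \<alpha> * t)\<^sup>2 / (1 - \<alpha>\<^sup>2) \<le> 1" using Cq a2 by (simp add: divide_le_eq)
  then have "((1 - \<alpha> * t)\<^sup>2 / (1 - \<alpha>\<^sup>2) + t\<^sup>2 - e) * L \<le> (1 + t\<^sup>2 - e) * L"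
    using L0 by (intro mult_right_mono) auto
  also have "\<dots> = L + t\<^sup>2 * L - e * L" by (simp add: algebra_simps)
  also have "\<dots> \<le> 1 - p" using err p(2) u_lo q_lo unfolding R_def by linarith
  also have "\<dots> \<le> - ln p" using ln_le_minus_one[OF p(1)] by simp
  finally show ?thesis using L by simp
qed

text \<open>Unites the three regimes with one \<open>\<delta>\<close> depending only on
  \<open>\<alpha>\<close> and \<open>e\<close>. The threshold \<open>L\<close> between small and
  large \<open>- ln u\<close> is fixed first, so that \<open>\<delta>\<close> can be taken small
  against it.\<close>

lemma exponent_le:
  fixes \<alpha> e :: real
  assumes \<alpha>: "0 < \<alpha>" "\<alpha> < 1" and e: "0 < e"
  shows "\<exists>\<delta>>0. \<forall>\<sigma> t u c p. \<alpha> < \<sigma> \<longrightarrow> \<sigma> \<le> \<alpha> + \<delta> \<longrightarrow> \<sigma> < t \<longrightarrow> t \<le> 1 / \<alpha> + \<delta> \<longrightarrow> 0 < u \<longrightarrow> u < 1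
      \<longrightarrow> 1 - \<delta> \<le> c \<longrightarrow> 0 < p \<longrightarrow> p \<le> u powr t\<^sup>2
      \<longrightarrow> (\<sigma> * t < 1 \<longrightarrow> p * c \<le> u powr ((t\<^sup>2 - 2 * \<sigma> * t + 1) / (1 - \<sigma>\<^sup>2)))
      \<longrightarrow> p \<le> u powr t\<^sup>2 + u - 1 + ((1 - u powr t\<^sup>2) * (1 - u)) powr (1 / (1 + \<sigma>)) / c
      \<longrightarrow> ((1 - \<alpha> * t)\<^sup>2 / (1 - \<alpha>\<^sup>2) + t\<^sup>2 - e) * - ln u \<le> - ln p"
proof -
  define \<tau> where "\<tau> = 1 / \<alpha> + 1"
  define \<kappa> where "\<kappa> = (1 - \<alpha>) / 4"
  \<comment> \<open>The first entry ensures \<open>\<tau>\<^sup>2 * L \<le> 1\<close>, the second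
    \<open>(\<tau>\<^sup>2 + 1)\<^sup>2 * L powr \<kappa> \<le> e\<close>.\<close>
  define L where "L = min (1 / \<tau>\<^sup>2) ((e / (\<tau>\<^sup>2 + 1)\<^sup>2) powr (1 / \<kappa>))"
  have \<tau>: "1 \<le> \<tau>" using \<alpha> by (simp add: \<tau>_def)
  have \<kappa>: "0 < \<kappa>" using \<alpha> by (simp add: \<kappa>_def)
  have a2: "\<alpha>\<^sup>2 < 1" using \<alpha> by (simp add: abs_square_less_1)
  have w: "0 < (\<tau>\<^sup>2 + 1)\<^sup>2" using \<tau> by (intro zero_less_power add_nonneg_pos) auto
  have L: "0 < L" using \<tau> e w by (auto simp: L_def)
  \<comment> \<open>In order: \<open>c \<ge> 1 / 2\<close>; the boundary regime;
    \<open>\<sigma> \<le> (1 + \<alpha>) / 2\<close>;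
    \<open>(1 - \<alpha> * t)\<^sup>2 \<le> 1 - \<alpha>\<^sup>2\<close> for the complements;
    replacing \<open>\<sigma>\<close> by \<open>\<alpha>\<close>; the conditioning loss.\<close>
  define \<delta> where "\<delta> = Min {1 / 2, \<alpha> * sqrt (e * (1 - \<alpha>\<^sup>2)), (1 - \<alpha>) / 2, 1 - \<alpha>\<^sup>2, e * (1 - \<alpha>\<^sup>2) / (4 * \<tau>), e * L / 4}"
  have \<delta>0: "0 < \<delta>" unfolding \<delta>_def using \<alpha> e a2 \<tau> L by (subst Min_gr_iff) auto
  have \<delta>: "\<delta> \<le> 1 / 2" "\<delta> \<le> \<alpha> * sqrt (e * (1 - \<alpha>\<^sup>2))" "\<delta> \<le> (1 - \<alpha>) / 2" "\<delta> \<le> 1 - \<alpha>\<^sup>2"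
      "\<delta> \<le> e * (1 - \<alpha>\<^sup>2) / (4 * \<tau>)" "\<delta> \<le> e * L / 4"
    unfolding \<delta>_def by (rule Min_le, simp, simp)+
  show ?thesis
  proof (intro exI[of _ \<delta>] conjI allI impI \<delta>0)
    fix \<sigma> t u c p :: real
    assume h: "\<alpha> < \<sigma>" "\<sigma> \<le> \<alpha> + \<delta>" "\<sigma> < t" "t \<le> 1 / \<alpha> + \<delta>" "0 < u" "u < 1" "1 - \<delta> \<le> c" "0 < p"
      "p \<le> u powr t\<^sup>2"
      "\<sigma> * t < 1 \<longrightarrow> p * c \<le> u powr ((t\<^sup>2 - 2 * \<sigma> * t + 1) / (1 - \<sigma>\<^sup>2))"
      "p \<le> u powr t\<^sup>2 + u - 1 + ((1 - u powr t\<^sup>2) * (1 - u)) powr (1 / (1 + \<sigma>)) / c"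
    have t\<tau>: "t \<le> \<tau>" using h \<delta> by (simp add: \<tau>_def)
    have \<sigma>: "\<sigma> \<le> (1 + \<alpha>) / 2" "\<sigma> < 1" using h \<delta> \<alpha> by (simp_all add: field_simps)
    consider "1 \<le> \<sigma> * t" | "\<sigma> * t < 1" "L \<le> - ln u" | "- ln u \<le> L" by linarith
    then show "((1 - \<alpha> * t)\<^sup>2 / (1 - \<alpha>\<^sup>2) + t\<^sup>2 - e) * - ln u \<le> - ln p"
    proof cases
      case 1
      have "\<delta> / \<alpha> \<le> sqrt (e * (1 - \<alpha>\<^sup>2))" using \<delta>(2) \<alpha> by (simp add: divide_le_eq mult.commute)
      then have "(\<delta> / \<alpha>)\<^sup>2 \<le> (sqrt (e * (1 - \<alpha>\<^sup>2)))\<^sup>2" using \<delta>0 \<alpha> by (intro power_mono) auto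
      also have "\<dots> = e * (1 - \<alpha>\<^sup>2)" using e a2 by simp
      finally show ?thesis
        using 1 h \<alpha> by (intro exponent_le_boundary[of \<alpha> \<sigma> \<delta> t e u p]) auto
    next
      case 2
      have "2 * \<delta> * \<tau> \<le> e / 2 * (1 - \<alpha>\<^sup>2)" using \<delta>(5) \<tau> by (simp add: field_simps)
      then show ?thesis
        using 2 h \<alpha> \<sigma> \<delta> t\<tau> e by (intro exponent_le_expansion[of \<alpha> \<sigma> \<delta> t \<tau> c e L u p]) auto
    next
      case 3
      have u: "0 < - ln u" using h by simp
      have "\<tau>\<^sup>2 * - ln u \<le> \<tau>\<^sup>2 * (1 / \<tau>\<^sup>2)"
        using 3 by (intro mult_left_mono) (auto simp: L_def)
      then have L1: "\<tau>\<^sup>2 * - ln u \<le> 1" using \<tau> by simp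
      have "(- ln u) powr \<kappa> \<le> ((e / (\<tau>\<^sup>2 + 1)\<^sup>2) powr (1 / \<kappa>)) powr \<kappa>"
        using 3 u \<kappa> by (intro powr_mono2) (auto simp: L_def)
      also have "\<dots> = e / (\<tau>\<^sup>2 + 1)\<^sup>2" using \<kappa> e w by (simp add: powr_powr)
      finally have L2: "(\<tau>\<^sup>2 + 1)\<^sup>2 * (- ln u) powr \<kappa> \<le> e" using w by (simp add: field_simps)
      have "\<alpha> * \<alpha> \<le> \<alpha> * t" using h \<alpha> by (intro mult_left_mono) auto
      then have "1 - \<alpha> * t \<le> 1 - \<alpha>\<^sup>2" by (simp add: power2_eq_square)
      moreover have "\<alpha> * t - 1 \<le> 1 - \<alpha>\<^sup>2"
      proof -
        have "\<alpha> * t \<le> \<alpha> * (1 / \<alpha> + \<delta>)" using h \<alpha> by (intro mult_left_mono) auto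
        also have "\<dots> = 1 + \<alpha> * \<delta>" using \<alpha> by (simp add: field_simps)
        also have "\<dots> \<le> 1 + \<delta>" using \<alpha> \<delta>0 by (simp add: mult_left_le_one_le)
        finally show ?thesis using \<delta>(4) by simp
      qed
      ultimately have "\<bar>1 - \<alpha> * t\<bar> \<le> \<bar>1 - \<alpha>\<^sup>2\<bar>" by linarith
      then have "(1 - \<alpha> * t)\<^sup>2 \<le> (1 - \<alpha>\<^sup>2)\<^sup>2" by (simp only: abs_le_square_iff)
      also have "\<dots> \<le> 1 - \<alpha>\<^sup>2" using a2 by (simp add: power2_eq_square mult_left_le_one_le)
      finally show ?thesis
        using h \<alpha> \<sigma> \<delta> t\<tau> \<tau>
        by (intro exponent_le_complement[of \<sigma> \<alpha> t \<tau> c, OF _ _ _ _ _ _ _ _ \<kappa>_def _ _ _ refl L1 L2])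
          auto
    qed
  qed
qed

text \<open>Both errors are relative to \<open>L\<close>, which cancels. Dividing by
  \<open>1 + \<epsilon>\<close> costs at most
  \<open>(C - e) * \<epsilon> \<le> K * \<epsilon>\<close>; when the claimed bound is not positive,
  the positive ratio exceeds it anyway.\<close>

lemma ratio_ge:
  fixes N D C K \<epsilon> e L :: real
  assumes "0 < N" "0 < D" "D \<le> (1 + \<epsilon>) * L" "0 < L" "(C - e) * L \<le> N" "C \<le> K" "0 \<le> \<epsilon>" "0 \<le> K" "0 \<le> e"
  shows "C - e - K * \<epsilon> \<le> N / D"
proof (cases "C - e \<le> 0")
  case True
  then have "C - e - K * \<epsilon> \<le> 0" using mult_nonneg_nonneg[of K \<epsilon>] assms by linarith
  then show ?thesis using assms by (simp add: order_trans[of _ 0])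
next
  case False
  have "(C - e - K * \<epsilon>) * D \<le> N"
  proof (cases "C - e - K * \<epsilon> \<le> 0")
    case True
    then show ?thesis using assms by (smt (verit) mult_nonpos_nonneg)
  next
    case nneg: False
    then have "(C - e - K * \<epsilon>) * D \<le> (C - e - K * \<epsilon>) * ((1 + \<epsilon>) * L)"
      using assms by (intro mult_left_mono) auto
    also have "(C - e - K * \<epsilon>) * (1 + \<epsilon>) \<le> C - e"
    proof -
      have "(C - e) * \<epsilon> \<le> K * \<epsilon>" using assms by (intro mult_right_mono) auto
      moreover have "0 \<le> K * \<epsilon> * \<epsilon>" using assms by simp
      ultimately show ?thesis by (simp add: algebra_simps)
    qed
    then have "(C - e - K * \<epsilon>) * ((1 + \<epsilon>) * L) \<le> (C - e) * L"
      using assms by (simp add: mult_right_mono flip: mult.assoc)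
    finally show ?thesis using assms by simp
  qed
  then show ?thesis using assms by (simp add: le_divide_eq)
qed

text \<open>This is why one bound on \<open>- ln p1\<close> serves both rates: \<open>ln pq\<close>
  takes away at most \<open>t\<^sup>2 * - ln u\<close>, and \<open>ln pu\<close> at most
  \<open>- ln u\<close>.\<close>

lemma update_exponent_eq:
  fixes \<alpha> t :: real
  assumes "\<alpha>\<^sup>2 < 1"
  shows "(t - \<alpha>)\<^sup>2 / (1 - \<alpha>\<^sup>2) = (1 - \<alpha> * t)\<^sup>2 / (1 - \<alpha>\<^sup>2) + t\<^sup>2 - 1"
  using assms by (simp add: field_simps power2_eq_square)

lemma exponents_le_of_bound:
  fixes \<alpha> M t :: real
  assumes "0 < \<alpha>" "\<alpha> < 1" "0 < t" "t \<le> M"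
  shows "(1 - \<alpha> * t)\<^sup>2 / (1 - \<alpha>\<^sup>2) \<le> (1 + M)\<^sup>2 / (1 - \<alpha>\<^sup>2)"
    and "(t - \<alpha>)\<^sup>2 / (1 - \<alpha>\<^sup>2) \<le> (1 + M)\<^sup>2 / (1 - \<alpha>\<^sup>2)"
proof -
  have a2: "\<alpha>\<^sup>2 < 1" using assms by (simp add: abs_square_less_1)
  have "0 \<le> \<alpha> * t" "\<alpha> * t \<le> t" using assms by (auto simp: mult_left_le_one_le)
  then have "\<bar>1 - \<alpha> * t\<bar> \<le> \<bar>1 + M\<bar>" "\<bar>t - \<alpha>\<bar> \<le> \<bar>1 + M\<bar>" using assms by linarith+
  then have "(1 - \<alpha> * t)\<^sup>2 \<le> (1 + M)\<^sup>2" "(t - \<alpha>)\<^sup>2 \<le> (1 + M)\<^sup>2" by (simp_all only: abs_le_square_iff)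
  then show "(1 - \<alpha> * t)\<^sup>2 / (1 - \<alpha>\<^sup>2) \<le> (1 + M)\<^sup>2 / (1 - \<alpha>\<^sup>2)"
    "(t - \<alpha>)\<^sup>2 / (1 - \<alpha>\<^sup>2) \<le> (1 + M)\<^sup>2 / (1 - \<alpha>\<^sup>2)"
    using a2 by (auto intro: divide_right_mono)
qed

section \<open>Asymptotics\<close>

text \<open>Bundles the hypotheses of the theorem, so that error terms can be formed as suprema over
  everything admissible at dimension \<open>d\<close>.\<close>

definition admissible ::
    "real \<Rightarrow> real \<Rightarrow> (nat \<Rightarrow> real) \<Rightarrow> nat \<Rightarrow> real \<Rightarrow> (point_filter \<times> point_filter) pmf \<Rightarrow>
      real \<Rightarrow> real \<Rightarrow> real \<Rightarrow> real \<Rightarrow> bool" where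
  "admissible \<alpha> \<beta> g d l F p1 p2 pq pu \<longleftrightarrow>
     d > 0 \<and>
     \<alpha> + 2 * sqrt (ln (real d) / real d) \<le> \<alpha> powr l \<and>
     \<alpha> powr l \<le> 1 / (\<alpha> - 2 * sqrt (ln (real d) / real d)) \<and>
     filter_family d F \<and>
     regular_family F \<and>
     sensitive d F ((1 - \<alpha>) * real d / 2) ((1 - \<beta>) * real d / 2) p1 p2 pq pu \<and>
     minimal_pq d F ((1 - \<alpha>) * real d / 2) ((1 - \<beta>) * real d / 2) p1 p2 pq pu \<and>
     (\<forall>(Q, U)\<in>set_pmf F. real (card Q) / 2 ^ d = (real (card U) / 2 ^ d) powr (\<alpha> powr (2 * l))) \<and>
     (\<forall>(Q, U)\<in>set_pmf F. real (card U) / 2 ^ d \<ge> 2 powr (- g d))"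

text \<open>Since \<open>d * (\<eta> d)\<^sup>2 = ln d\<close>, the failure probability of close
  pairs tends to 0 together with \<open>\<eta>\<close>. The constant 16 halves the exponent of
  \<open>close_mass_0_le\<close>, leaving one factor to compare with \<open>u\<close> and one that
  tends to 0.\<close>

lemma eventually_parameters:
  fixes \<alpha> \<beta> \<delta> :: real and g :: "nat \<Rightarrow> real"
  assumes "0 < \<alpha>" "0 < \<beta>" "g \<in> o(\<lambda>d. real d)" "0 < \<delta>"
  defines "\<eta> \<equiv> \<lambda>d. sqrt (ln (real d) / real d)"
  shows "\<forall>\<^sub>F d in sequentially. 0 < \<eta> d \<and> \<eta> d \<le> \<delta> \<and> 1 / (\<alpha> - 2 * \<eta> d) \<le> 1 / \<alpha> + \<delta>
    \<and> exp (- (real d * (\<eta> d)\<^sup>2 / 8)) \<le> \<delta> \<and> exp (- (real d * \<beta>\<^sup>2 / 16)) \<le> \<delta>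
    \<and> exp (- (real d * \<beta>\<^sup>2 / 16)) \<le> 2 powr (- g d)"
proof -
  have lim: "\<eta> \<longlonglongrightarrow> 0" unfolding \<eta>_def by real_asymp
  have small: "\<forall>\<^sub>F d in sequentially. f d \<le> c" if "f \<longlonglongrightarrow> m" "m < c" for f :: "nat \<Rightarrow> real" and m c
    using order_tendstoD(2)[OF that] by eventually_elim simp
  have "(\<lambda>d. 1 / (\<alpha> - 2 * \<eta> d)) \<longlonglongrightarrow> 1 / (\<alpha> - 2 * 0)"
    using assms(1) by (intro tendsto_intros lim) auto
  then have e2: "\<forall>\<^sub>F d in sequentially. 1 / (\<alpha> - 2 * \<eta> d) \<le> 1 / \<alpha> + \<delta>"
    using assms by (intro small) auto
  have "(\<lambda>d::nat. exp (- (ln (real d) / 8))) \<longlonglongrightarrow> 0" by real_asymp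
  then have e3: "\<forall>\<^sub>F d in sequentially. exp (- (ln (real d) / 8)) \<le> \<delta>"
    using assms by (intro small) auto
  have "0 < \<beta>\<^sup>2" using assms by simp
  then have "(\<lambda>d::nat. exp (- (real d * \<beta>\<^sup>2 / 16))) \<longlonglongrightarrow> 0" by real_asymp
  then have e4: "\<forall>\<^sub>F d in sequentially. exp (- (real d * \<beta>\<^sup>2 / 16)) \<le> \<delta>"
    using assms by (intro small) auto
  have e5: "\<forall>\<^sub>F d in sequentially. norm (g d) \<le> \<beta>\<^sup>2 / (16 * ln 2) * norm (real d)"
    by (rule landau_o.smallD[OF assms(3)]) (use assms in auto)
  show ?thesis
    using e2 e3 e4 e5 small[OF lim assms(4)] eventually_gt_at_top[of 1]
  proof eventually_elim
    case (elim d)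
    have "0 < ln (real d) / real d" using elim by simp
    then have \<eta>: "0 < \<eta> d" "real d * (\<eta> d)\<^sup>2 = ln (real d)"
      unfolding \<eta>_def using elim by (simp_all del: zero_less_divide_iff)
    have "g d \<le> \<beta>\<^sup>2 / (16 * ln 2) * real d" using elim by simp
    then have "g d * ln 2 \<le> \<beta>\<^sup>2 / (16 * ln 2) * real d * ln 2" by (intro mult_right_mono) auto
    also have "\<dots> = real d * \<beta>\<^sup>2 / 16" by simp
    finally have "exp (- (real d * \<beta>\<^sup>2 / 16)) \<le> 2 powr (- g d)" by (simp add: powr_def)
    then show ?case using elim \<eta> by simp
  qed
qed

text \<open>The threshold for \<open>d\<close> must not depend on \<open>l\<close> or on the family,
  so all asymptotic facts come from \<open>eventually_parameters\<close> before these are fixed.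
  Numerator and denominator errors get \<open>e / 2\<close> each.\<close>

lemma deficit_eventually_le:
  fixes \<alpha> \<beta> e :: real and g :: "nat \<Rightarrow> real"
  assumes \<beta>: "0 < \<beta>" and "\<beta> < \<alpha>" and \<alpha>1: "\<alpha> < 1" and g: "g \<in> o(\<lambda>d. real d)" and e: "0 < e"
  shows "\<forall>\<^sub>F d in sequentially. \<forall>l F p1 p2 pq pu. admissible \<alpha> \<beta> g d l F p1 p2 pq pu \<longrightarrow>
    (1 - \<alpha> powr (1 + l))\<^sup>2 / (1 - \<alpha>\<^sup>2) - rho_q p1 p2 pq \<le> e \<and>
    (\<alpha> powr l - \<alpha>)\<^sup>2 / (1 - \<alpha>\<^sup>2) - rho_u p1 p2 pq pu \<le> e"
proof -
  have \<alpha>: "0 < \<alpha>" "\<alpha> < 1" using assms by auto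
  have a2: "\<alpha>\<^sup>2 < 1" using \<alpha> by (simp add: abs_square_less_1)
  define K where "K = (1 + (1 / \<alpha> + 1))\<^sup>2 / (1 - \<alpha>\<^sup>2)"
  have "0 < 1 + (1 / \<alpha> + 1)" using \<alpha> by (simp add: add_pos_pos)
  then have K: "0 < K" using a2 unfolding K_def by (intro divide_pos_pos zero_less_power) auto
  obtain \<delta>0 where \<delta>0: "0 < \<delta>0" and core: "\<And>\<sigma> t u c p. \<alpha> < \<sigma> \<Longrightarrow> \<sigma> \<le> \<alpha> + \<delta>0 \<Longrightarrow> \<sigma> < t \<Longrightarrow> t \<le> 1 / \<alpha> + \<delta>0 \<Longrightarrow> 0 < u \<Longrightarrow> u < 1
      \<Longrightarrow> 1 - \<delta>0 \<le> c \<Longrightarrow> 0 < p \<Longrightarrow> p \<le> u powr t\<^sup>2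
      \<Longrightarrow> (\<sigma> * t < 1 \<longrightarrow> p * c \<le> u powr ((t\<^sup>2 - 2 * \<sigma> * t + 1) / (1 - \<sigma>\<^sup>2)))
      \<Longrightarrow> p \<le> u powr t\<^sup>2 + u - 1 + ((1 - u powr t\<^sup>2) * (1 - u)) powr (1 / (1 + \<sigma>)) / c
      \<Longrightarrow> ((1 - \<alpha> * t)\<^sup>2 / (1 - \<alpha>\<^sup>2) + t\<^sup>2 - e / 2) * - ln u \<le> - ln p"
    using exponent_le[of \<alpha> "e / 2"] \<alpha> e by (metis half_gt_zero)
  \<comment> \<open>\<open>1 / 2\<close> gives \<open>T \<le> u / 2\<close> and
    \<open>c > 0\<close>, \<open>(1 - \<alpha>) / 2\<close> gives \<open>\<sigma> < 1\<close>, and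
    \<open>e / (4 * K)\<close> brings \<open>K * \<epsilon> \<le> 2 * K * \<delta>\<close> down to
    \<open>e / 2\<close>.\<close>
  define \<delta> where "\<delta> = Min {\<delta>0, 1 / 2, (1 - \<alpha>) / 2, e / (4 * K)}"
  have \<delta>: "0 < \<delta>" unfolding \<delta>_def using \<delta>0 \<alpha> e K by (subst Min_gr_iff) auto
  have \<delta>le: "\<delta> \<le> \<delta>0" "\<delta> \<le> 1 / 2" "\<delta> \<le> (1 - \<alpha>) / 2" "\<delta> \<le> e / (4 * K)"
    unfolding \<delta>_def by (rule Min_le, simp, simp)+
  show ?thesis
    using eventually_parameters[OF \<alpha>(1) \<beta> g \<delta>]
  proof (eventually_elim, intro allI impI)
    fix d l F p1 p2 pq pu
    assume ev: "0 < sqrt (ln (real d) / real d) \<and> sqrt (ln (real d) / real d) \<le> \<delta>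
        \<and> 1 / (\<alpha> - 2 * sqrt (ln (real d) / real d)) \<le> 1 / \<alpha> + \<delta>
        \<and> exp (- (real d * (sqrt (ln (real d) / real d))\<^sup>2 / 8)) \<le> \<delta> \<and> exp (- (real d * \<beta>\<^sup>2 / 16)) \<le> \<delta>
        \<and> exp (- (real d * \<beta>\<^sup>2 / 16)) \<le> 2 powr (- g d)"
      and adm: "admissible \<alpha> \<beta> g d l F p1 p2 pq pu"
    define \<eta> where "\<eta> = sqrt (ln (real d) / real d)"
    define t where "t = \<alpha> powr l"
    define x where "x = exp (- (real d * \<beta>\<^sup>2 / 16))"
    have ev: "0 < \<eta>" "\<eta> \<le> \<delta>" "1 / (\<alpha> - 2 * \<eta>) \<le> 1 / \<alpha> + \<delta>" "exp (- (real d * \<eta>\<^sup>2 / 8)) \<le> \<delta>"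
        "x \<le> \<delta>" "x \<le> 2 powr (- g d)"
      using ev by (auto simp: \<eta>_def x_def)
    have t: "\<alpha> + 2 * \<eta> \<le> t" "t \<le> 1 / \<alpha> + \<delta>" "0 < t"
      using adm ev(3) \<alpha> by (auto simp: admissible_def \<eta>_def t_def)
    have tt: "\<alpha> powr (1 + l) = \<alpha> * t" "\<alpha> powr (2 * l) = t\<^sup>2"
      using \<alpha> unfolding t_def power2_eq_square mult_2 powr_add by simp_all
    obtain a b where ab: "\<forall>(Q, U)\<in>set_pmf F. card Q = a \<and> card U = b"
      using adm by (auto simp: admissible_def regular_family_def)
    define q u where "q = real a / 2 ^ d" and "u = real b / 2 ^ d"
    define r1 r2 where "r1 = (1 - \<alpha>) * real d / 2" and "r2 = (1 - \<beta>) * real d / 2"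
    interpret regular_filter_family d F r1 r2 p1 p2 pq pu q u
      using adm ab by unfold_locales (auto simp: admissible_def q_def u_def r1_def r2_def)
    have min: "minimal_pq d F r1 r2 p1 p2 pq pu"
      using adm by (simp add: admissible_def r1_def r2_def)
    obtain Q U where QU: "(Q, U) \<in> set_pmf F" using set_pmf_not_empty[of F] by (metis ex_in_conv surj_pair)
    have q: "q = u powr t\<^sup>2" and ux: "x \<le> u"
      using adm QU card_query[OF QU] card_update[OF QU] ev(6) tt(2) by (auto simp: admissible_def)
    have x0: "0 < x" by (simp add: x_def)
    then have u0: "0 < u" using ux by linarith
    define T where "T = close_mass d 0 r2"
    have "T \<le> exp (- (real d * \<beta>\<^sup>2 / 8))"
      unfolding T_def r2_def using assms by (intro close_mass_0_le) auto
    \<comment> \<open>One factor \<open>x\<close> is absorbed by \<open>u \<ge> x\<close>, the other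
      keeps \<open>T / u\<close> small.\<close>
    also have "\<dots> = x * x" by (simp add: x_def flip: exp_add)
    also have "\<dots> \<le> x * u" using ux x0 by (intro mult_left_mono) auto
    finally have T: "T \<le> x * u" "0 \<le> T" by (auto simp: T_def close_mass_nonneg)
    have xu: "x * u \<le> (1 / 2) * u" using ev(5) \<delta>le(2) u0 by (intro mult_right_mono) auto
    have Tu: "T < u" "u / 2 \<le> u - T" using T xu u0 by linarith+
    have u1: "u < 1" using update_density_less_1[OF min] Tu density_bounds unfolding T_def by linarith
    define \<epsilon> where "\<epsilon> = T / (u - T)"
    have "\<epsilon> \<le> (x * u) / (u / 2)" unfolding \<epsilon>_def using T Tu u0 by (intro frac_le) auto
    also have "\<dots> = 2 * x" using u0 by simp
    finally have \<epsilon>: "0 \<le> \<epsilon>" "\<epsilon> \<le> 2 * \<delta>" using ev(5) T Tu by (auto simp: \<epsilon>_def)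
    define \<sigma> where "\<sigma> = \<alpha> + \<eta>"
    define c where "c = close_mass d \<sigma> r1"
    have \<sigma>: "\<alpha> < \<sigma>" "\<sigma> \<le> \<alpha> + \<delta>" "\<sigma> < t" "\<sigma> < 1" "0 < \<sigma>"
      using ev t \<alpha> \<delta>le(3) by (auto simp: \<sigma>_def)
    have "1 - c \<le> exp (- (real d * \<eta>\<^sup>2 / 8))"
      unfolding c_def \<sigma>_def r1_def using \<alpha> ev(1) \<sigma>(4) by (intro one_minus_close_mass_le) (auto simp: \<sigma>_def)
    then have c: "1 - \<delta> \<le> c" using ev(4) by linarith
    then have c0: "0 < c" using \<delta>le(2) by linarith
    have r1: "0 \<le> r1" using \<alpha> by (simp add: r1_def)
    define Cq where "Cq = (1 - \<alpha> * t)\<^sup>2 / (1 - \<alpha>\<^sup>2)"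
    define Cu where "Cu = (t - \<alpha>)\<^sup>2 / (1 - \<alpha>\<^sup>2)"
    have CuCq: "Cu = Cq + t\<^sup>2 - 1"
      unfolding Cu_def Cq_def by (rule update_exponent_eq[OF a2])
    have CK: "Cq \<le> K" "Cu \<le> K"
      unfolding Cq_def Cu_def K_def using \<alpha> t \<delta>le(2) by (intro exponents_le_of_bound; simp)+
    have p1: "0 < p1" using p_order by linarith
    have key: "(Cq + t\<^sup>2 - e / 2) * - ln u \<le> - ln p1"
      unfolding Cq_def
    proof (rule core[where \<sigma> = \<sigma> and c = c])
      show "p1 \<le> u powr t\<^sup>2" using p1_le_query_density[OF r1] q by simp
      show "\<sigma> * t < 1 \<longrightarrow> p1 * c \<le> u powr ((t\<^sup>2 - 2 * \<sigma> * t + 1) / (1 - \<sigma>\<^sup>2))"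
        unfolding c_def using p1_close_mass_le_expansion[of \<sigma> t] \<sigma> q by blast
      show "p1 \<le> u powr t\<^sup>2 + u - 1 + ((1 - u powr t\<^sup>2) * (1 - u)) powr (1 / (1 + \<sigma>)) / c"
        using p1_le_complement[of \<sigma>] \<sigma> c0 unfolding c_def q by blast
    qed (use \<sigma> \<delta>le(1) t u0 u1 c p1 in auto)
    have L: "0 < - ln u" using u0 u1 by simp
    have lnq: "- (t\<^sup>2 * - ln u) \<le> ln pq"
      using ln_mono[OF query_density_le] u0 unfolding q by (simp add: ln_powr)
    have lnu: "ln u \<le> ln pu" using ln_mono[OF update_density_le u0] .
    have D: "0 < ln (pq / p2)" "ln (pq / p2) \<le> (1 + \<epsilon>) * - ln u"
      using p_order ln_pq_p2_le[OF min] Tu(1) unfolding \<epsilon>_def T_def by auto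
    have "Cq - e / 2 - K * \<epsilon> \<le> rho_q p1 p2 pq"
      unfolding rho_q_def
    proof (rule ratio_ge[OF _ D L])
      have "(Cq - e / 2) * - ln u = (Cq + t\<^sup>2 - e / 2) * - ln u + - (t\<^sup>2 * - ln u)" by (simp add: algebra_simps)
      also have "\<dots> \<le> - ln p1 + ln pq" using key lnq by (rule add_mono)
      also have "\<dots> = ln (pq / p1)" using p_order by (simp add: ln_div)
      finally show "(Cq - e / 2) * - ln u \<le> ln (pq / p1)" .
    qed (use p_order K CK e \<epsilon> in auto)
    moreover have "Cu - e / 2 - K * \<epsilon> \<le> rho_u p1 p2 pq pu"
      unfolding rho_u_def
    proof (rule ratio_ge[OF _ D L])
      have "(Cu - e / 2) * - ln u = (Cq + t\<^sup>2 - e / 2) * - ln u + ln u"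
        unfolding CuCq by (simp add: algebra_simps)
      also have "\<dots> \<le> - ln p1 + ln pu" using key lnu by (rule add_mono)
      also have "\<dots> = ln (pu / p1)" using p_order by (simp add: ln_div)
      finally show "(Cu - e / 2) * - ln u \<le> ln (pu / p1)" .
    qed (use p_order K CK e \<epsilon> in auto)
    moreover have "K * \<epsilon> \<le> e / 2"
    proof -
      have "K * \<epsilon> \<le> K * (2 * (e / (4 * K)))" using \<epsilon>(2) \<delta>le(4) K by (intro mult_left_mono) auto
      also have "\<dots> = e / 2" using K by simp
      finally show ?thesis .
    qed
    ultimately show "(1 - \<alpha> powr (1 + l))\<^sup>2 / (1 - \<alpha>\<^sup>2) - rho_q p1 p2 pq \<le> e \<and>
      (\<alpha> powr l - \<alpha>)\<^sup>2 / (1 - \<alpha>\<^sup>2) - rho_u p1 p2 pq pu \<le> e"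
      unfolding tt(1) by (simp add: Cq_def Cu_def t_def[symmetric])
  qed
qed

text \<open>Makes the suprema finite at every single \<open>d\<close>, not only for large ones: the
  rates are nonnegative and the hypothesis caps \<open>\<alpha> powr l\<close>. If
  \<open>\<alpha> - 2 * sqrt (ln (real d) / real d)\<close> is not positive, neither is the cap
  (division by 0 gives 0), and no \<open>l\<close> is admissible.\<close>

lemma deficit_bounded:
  fixes \<alpha> \<beta> :: real and g :: "nat \<Rightarrow> real"
  assumes \<alpha>: "0 < \<alpha>" "\<alpha> < 1" and adm: "admissible \<alpha> \<beta> g d l F p1 p2 pq pu"
  defines "B \<equiv> (1 + 1 / (\<alpha> - 2 * sqrt (ln (real d) / real d)))\<^sup>2 / (1 - \<alpha>\<^sup>2)"
  shows "(1 - \<alpha> powr (1 + l))\<^sup>2 / (1 - \<alpha>\<^sup>2) - rho_q p1 p2 pq \<le> B"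
    and "(\<alpha> powr l - \<alpha>)\<^sup>2 / (1 - \<alpha>\<^sup>2) - rho_u p1 p2 pq pu \<le> B"
proof -
  have p: "0 < p2" "p2 < p1" "p1 < pq" "p1 < pu" using adm by (auto simp: admissible_def sensitive_def)
  then have "0 \<le> rho_q p1 p2 pq" "0 \<le> rho_u p1 p2 pq pu"
    unfolding rho_q_def rho_u_def by (auto intro!: divide_nonneg_nonneg)
  moreover have "(1 - \<alpha> powr (1 + l))\<^sup>2 / (1 - \<alpha>\<^sup>2) \<le> B" "(\<alpha> powr l - \<alpha>)\<^sup>2 / (1 - \<alpha>\<^sup>2) \<le> B"
    unfolding B_def powr_add using \<alpha> adm exponents_le_of_bound[of \<alpha> "\<alpha> powr l"]
    by (simp_all add: admissible_def)
  ultimately show "(1 - \<alpha> powr (1 + l))\<^sup>2 / (1 - \<alpha>\<^sup>2) - rho_q p1 p2 pq \<le> B"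
    "(\<alpha> powr l - \<alpha>)\<^sup>2 / (1 - \<alpha>\<^sup>2) - rho_u p1 p2 pq pu \<le> B" by linarith+
qed

text \<open>Turns "for every \<open>e\<close>, eventually" into a single error function, the
  supremum of the deficits at each \<open>d\<close>.\<close>

lemma uniform_error_term:
  fixes D :: "nat \<Rightarrow> real set"
  assumes "\<And>d. bdd_above (D d)" "\<And>e. 0 < e \<Longrightarrow> \<forall>\<^sub>F d in sequentially. \<forall>x\<in>D d. x \<le> e"
  shows "\<exists>err. err \<in> o(\<lambda>_. 1) \<and> (\<forall>d. \<forall>x\<in>D d. x \<le> err d)"
proof -
  \<comment> \<open>Inserting 0 covers dimensions with empty \<open>D d\<close> and makes
    \<open>err\<close> nonnegative, so its norm is its value.\<close>
  define err where "err d = Sup (insert 0 (D d))" for d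
  have bdd: "bdd_above (insert 0 (D d))" for d using assms(1) by simp
  have nonneg: "0 \<le> err d" for d unfolding err_def using bdd by (intro cSup_upper) auto
  have "err \<in> o(\<lambda>_. 1)"
  proof (rule landau_o.smallI)
    fix e :: real assume e: "0 < e"
    show "\<forall>\<^sub>F d in sequentially. norm (err d) \<le> e * norm (1 :: real)"
      using assms(2)[OF e]
    proof eventually_elim
      case (elim d)
      then have "err d \<le> e" unfolding err_def using e by (intro cSup_least) auto
      then show ?case using nonneg by simp
    qed
  qed
  moreover have "\<forall>d. \<forall>x\<in>D d. x \<le> err d"
    unfolding err_def using bdd by (auto intro: cSup_upper)
  ultimately show ?thesis by blast
qed

theorem theorem1p5:
  fixes \<alpha> \<beta> :: real and g :: "nat \<Rightarrow> real"
  assumes "0 < \<beta>" and "\<beta> < \<alpha>" and "\<alpha> < 1"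
    and "g \<in> o(\<lambda>d. real d)"
  shows "\<exists>err_q err_u :: nat \<Rightarrow> real.
    err_q \<in> o(\<lambda>_. 1) \<and> err_u \<in> o(\<lambda>_. 1) \<and>
    (\<forall>(d::nat) (l::real) F p1 p2 pq pu.
       d > 0 \<longrightarrow>
       \<alpha> + 2 * sqrt (ln (real d) / real d) \<le> \<alpha> powr l \<longrightarrow>
       \<alpha> powr l \<le> 1 / (\<alpha> - 2 * sqrt (ln (real d) / real d)) \<longrightarrow>
       filter_family d F \<longrightarrow>
       regular_family F \<longrightarrow>
       sensitive d F ((1 - \<alpha>) * real d / 2) ((1 - \<beta>) * real d / 2) p1 p2 pq pu \<longrightarrow>
       minimal_pq d F ((1 - \<alpha>) * real d / 2) ((1 - \<beta>) * real d / 2) p1 p2 pq pu \<longrightarrow>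
       (\<forall>(Q, U)\<in>set_pmf F.
          real (card Q) / 2 ^ d = (real (card U) / 2 ^ d) powr (\<alpha> powr (2 * l))) \<longrightarrow>
       (\<forall>(Q, U)\<in>set_pmf F. real (card U) / 2 ^ d \<ge> 2 powr (- g d)) \<longrightarrow>
       rho_q p1 p2 pq \<ge> (1 - \<alpha> powr (1 + l))\<^sup>2 / (1 - \<alpha>\<^sup>2) - err_q d \<and>
       rho_u p1 p2 pq pu \<ge> (\<alpha> powr l - \<alpha>)\<^sup>2 / (1 - \<alpha>\<^sup>2) - err_u d)"
proof -
  have \<alpha>: "0 < \<alpha>" using assms by linarith
  define Dq where "Dq d = {(1 - \<alpha> powr (1 + l))\<^sup>2 / (1 - \<alpha>\<^sup>2) - rho_q p1 p2 pq | l F p1 p2 pq pu.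
    admissible \<alpha> \<beta> g d l F p1 p2 pq pu}" for d
  define Du where "Du d = {(\<alpha> powr l - \<alpha>)\<^sup>2 / (1 - \<alpha>\<^sup>2) - rho_u p1 p2 pq pu | l F p1 p2 pq pu.
    admissible \<alpha> \<beta> g d l F p1 p2 pq pu}" for d
  have "\<exists>err. err \<in> o(\<lambda>_. 1) \<and> (\<forall>d. \<forall>x\<in>Dq d. x \<le> err d)"
  proof (rule uniform_error_term)
    show "bdd_above (Dq d)" for d
      unfolding Dq_def by (rule bdd_aboveI) (use deficit_bounded(1)[OF \<alpha> assms(3)] in blast)
    show "\<forall>\<^sub>F d in sequentially. \<forall>x\<in>Dq d. x \<le> e" if "0 < e" for e
      using deficit_eventually_le[OF assms that] unfolding Dq_def by eventually_elim blast
  qed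
  then obtain err_q where q: "err_q \<in> o(\<lambda>_. 1)" "\<And>d x. x \<in> Dq d \<Longrightarrow> x \<le> err_q d" by blast
  have "\<exists>err. err \<in> o(\<lambda>_. 1) \<and> (\<forall>d. \<forall>x\<in>Du d. x \<le> err d)"
  proof (rule uniform_error_term)
    show "bdd_above (Du d)" for d
      unfolding Du_def by (rule bdd_aboveI) (use deficit_bounded(2)[OF \<alpha> assms(3)] in blast)
    show "\<forall>\<^sub>F d in sequentially. \<forall>x\<in>Du d. x \<le> e" if "0 < e" for e
      using deficit_eventually_le[OF assms that] unfolding Du_def by eventually_elim blast
  qed
  then obtain err_u where u: "err_u \<in> o(\<lambda>_. 1)" "\<And>d x. x \<in> Du d \<Longrightarrow> x \<le> err_u d" by blast
  have bound: "rho_q p1 p2 pq \<ge> (1 - \<alpha> powr (1 + l))\<^sup>2 / (1 - \<alpha>\<^sup>2) - err_q d \<and>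
      rho_u p1 p2 pq pu \<ge> (\<alpha> powr l - \<alpha>)\<^sup>2 / (1 - \<alpha>\<^sup>2) - err_u d"
    if "admissible \<alpha> \<beta> g d l F p1 p2 pq pu" for d l F p1 p2 pq pu
  proof -
    have "(1 - \<alpha> powr (1 + l))\<^sup>2 / (1 - \<alpha>\<^sup>2) - rho_q p1 p2 pq \<in> Dq d"
      "(\<alpha> powr l - \<alpha>)\<^sup>2 / (1 - \<alpha>\<^sup>2) - rho_u p1 p2 pq pu \<in> Du d"
      unfolding Dq_def Du_def using that by blast+
    then show ?thesis using q(2) u(2) by (smt (verit))
  qed
  show ?thesis
    by (intro exI[of _ err_q] exI[of _ err_u] conjI q(1) u(1) allI impI; rule bound[THEN conjunct1] bound[THEN conjunct2])
      (auto simp: admissible_def)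
qed

end
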